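(* Let $T$ be a complete first-order theory (countable or uncountable) with monster model $\mathcal U$, let $M$ be a model of $T$, and let $p(x)$ be a global $M$-invariant type. Suppose there is an elementary extension $M'\succ M$ containing a Morley sequence of $p$ such that $M'$ is eventually NIP. Then the following are equivalent: (i) $p=\lim tp(a_i/\mathcal U)$ for every $(a_i)\models p^{(\omega)}|_M$. (ii) $p$ is definable over and finitely satisfiable in $M$. (iii) $p_x\otimes p_y=p_y\otimes p_x$. (iv) Every Morley sequence of $p$ is totally indiscernible.
   Context: $p^{(\omega)}|_M$ is the type of a Morley sequence of $p$ over $M$, i.e. of $(a_i)_{i<\omega}$ with $a_i\models p|_{Ma_{<i}}$. $\lim tp(a_i/\mathcal U)=p$ means: for each $L(\mathcal U)$-formula $\phi$, $\phi\in p$ iff $\phi(a_i)$ holds for all large $i$. $p_x\otimes q_y$ is the Morley product: $(a,b)\models(p_x\otimes q_y)|_B$ iff $b\models q|_B$ and $a\models p|_{Bb}$. A formula $\phi(x,y)$ (possibly with parameters) is eventually NIP in $M'$ if for every infinite sequence $(c_i)$ in $M'$ there are a subsequence $(a_i)$, $n\in\mathbb N$ and $E\subseteq\{1,\dots,n\}$ with $\mathcal U\models\neg\exists y\big(\bigwedge_{j\in E}\phi(a_{i_j},y)\wedge\bigwedge_{j\notin E}\neg\phi(a_{i_j},y)\big)$ for all $i_1<\dots<i_n$; $M'$ is eventually NIP if every formula is eventually NIP in $M'$. *)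

theory Defs
  imports Complex_Main
begin

unbundle cardinal_syntax

text \<open>
  First-order logic with equality. Variables are named by natural numbers. A formula may mention
  elements of a universe \<^typ>\<open>'u\<close> as parameters (\<open>Par\<close>); the generated functions \<open>tpars\<close> and
  \<open>pars\<close> return the sets of parameters, and the third argument of the generated \<open>map_fm\<close> acts
  on parameters.
\<close>

datatype ('f, tpars: 'u) tm =
    Var nat
  | Par 'u
  | Fn 'f "('f, 'u) tm list"

datatype ('f, 'r, pars: 'u) fm =
    Eq "('f, 'u) tm" "('f, 'u) tm"
  | Rel 'r "('f, 'u) tm list"
  | Neg "('f, 'r, 'u) fm"
  | Conj "('f, 'r, 'u) fm" "('f, 'r, 'u) fm"
  | Ex nat "('f, 'r, 'u) fm"

text \<open>A language is a set of function symbols and a set of relation symbols, with arities.\<close>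

record ('f, 'r) lang =
  Funs :: "('f \<times> nat) set"
  Rels :: "('r \<times> nat) set"

fun wf_tm :: "('f, 'r) lang \<Rightarrow> ('f, 'u) tm \<Rightarrow> bool" where
  "wf_tm L (Var i) = True"
| "wf_tm L (Par a) = True"
| "wf_tm L (Fn f ts) = ((f, length ts) \<in> Funs L \<and> (\<forall>t\<in>set ts. wf_tm L t))"

primrec wf_fm :: "('f, 'r) lang \<Rightarrow> ('f, 'r, 'u) fm \<Rightarrow> bool" where
  "wf_fm L (Eq s t) = (wf_tm L s \<and> wf_tm L t)"
| "wf_fm L (Rel R ts) = ((R, length ts) \<in> Rels L \<and> (\<forall>t\<in>set ts. wf_tm L t))"
| "wf_fm L (Neg \<phi>) = wf_fm L \<phi>"
| "wf_fm L (Conj \<phi> \<psi>) = (wf_fm L \<phi> \<and> wf_fm L \<psi>)"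
| "wf_fm L (Ex i \<phi>) = wf_fm L \<phi>"

fun fv_tm :: "('f, 'u) tm \<Rightarrow> nat set" where
  "fv_tm (Var i) = {i}"
| "fv_tm (Par a) = {}"
| "fv_tm (Fn f ts) = (\<Union>t\<in>set ts. fv_tm t)"

primrec fv :: "('f, 'r, 'u) fm \<Rightarrow> nat set" where
  "fv (Eq s t) = fv_tm s \<union> fv_tm t"
| "fv (Rel R ts) = (\<Union>t\<in>set ts. fv_tm t)"
| "fv (Neg \<phi>) = fv \<phi>"
| "fv (Conj \<phi> \<psi>) = fv \<phi> \<union> fv \<psi>"
| "fv (Ex i \<phi>) = fv \<phi> - {i}"

text \<open>Replacing the free variables in the domain of \<open>s\<close> by parameters (never a capture).\<close>

primrec inst_tm :: "(nat \<Rightarrow> 'u option) \<Rightarrow> ('f, 'u) tm \<Rightarrow> ('f, 'u) tm" where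
  "inst_tm s (Var i) = (case s i of None \<Rightarrow> Var i | Some a \<Rightarrow> Par a)"
| "inst_tm s (Par a) = Par a"
| "inst_tm s (Fn f ts) = Fn f (map (inst_tm s) ts)"

primrec inst :: "(nat \<Rightarrow> 'u option) \<Rightarrow> ('f, 'r, 'u) fm \<Rightarrow> ('f, 'r, 'u) fm" where
  "inst s (Eq t u) = Eq (inst_tm s t) (inst_tm s u)"
| "inst s (Rel R ts) = Rel R (map (inst_tm s) ts)"
| "inst s (Neg \<phi>) = Neg (inst s \<phi>)"
| "inst s (Conj \<phi> \<psi>) = Conj (inst s \<phi>) (inst s \<psi>)"
| "inst s (Ex i \<phi>) = Ex i (inst (s(i := None)) \<phi>)"

text \<open>\<open>\<phi>(x, b)\<close> for \<open>\<phi>(x, y)\<close> with \<open>x = (v\<^sub>0, \<dots>, v\<^sub>n\<^sub>-\<^sub>1)\<close>, \<open>y = (v\<^sub>n, v\<^sub>n\<^sub>+\<^sub>1, \<dots>)\<close>.\<close>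

definition plug :: "nat \<Rightarrow> 'u list \<Rightarrow> ('f, 'r, 'u) fm \<Rightarrow> ('f, 'r, 'u) fm" where
  "plug n b \<phi> = inst (\<lambda>i. if n \<le> i \<and> i < n + length b then Some (b ! (i - n)) else None) \<phi>"

record ('f, 'r, 'u) struct =
  Dom :: "'u set"
  Fint :: "'f \<Rightarrow> 'u list \<Rightarrow> 'u"
  Rint :: "'r \<Rightarrow> 'u list \<Rightarrow> bool"

text \<open>Tuples are lists.\<close>

definition tuples :: "'u set \<Rightarrow> nat \<Rightarrow> 'u list set" where
  "tuples A n = {a. length a = n \<and> set a \<subseteq> A}"

definition is_struct :: "('f, 'r) lang \<Rightarrow> ('f, 'r, 'u) struct \<Rightarrow> bool" where
  "is_struct L S \<longleftrightarrow>
     Dom S \<noteq> {} \<and> (\<forall>(f, k)\<in>Funs L. \<forall>a\<in>tuples (Dom S) k. Fint S f a \<in> Dom S)"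

primrec eval :: "('f, 'r, 'u) struct \<Rightarrow> (nat \<Rightarrow> 'u) \<Rightarrow> ('f, 'u) tm \<Rightarrow> 'u" where
  "eval S e (Var i) = e i"
| "eval S e (Par a) = a"
| "eval S e (Fn f ts) = Fint S f (map (eval S e) ts)"

primrec sat :: "('f, 'r, 'u) struct \<Rightarrow> (nat \<Rightarrow> 'u) \<Rightarrow> ('f, 'r, 'u) fm \<Rightarrow> bool" where
  "sat S e (Eq s t) = (eval S e s = eval S e t)"
| "sat S e (Rel R ts) = Rint S R (map (eval S e) ts)"
| "sat S e (Neg \<phi>) = (\<not> sat S e \<phi>)"
| "sat S e (Conj \<phi> \<psi>) = (sat S e \<phi> \<and> sat S e \<psi>)"
| "sat S e (Ex i \<phi>) = (\<exists>u\<in>Dom S. sat S (e(i := u)) \<phi>)"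

text \<open>\<open>L(A)\<close>-formulas with free variables in \<open>V\<close>.\<close>

definition Forms :: "('f, 'r) lang \<Rightarrow> 'u set \<Rightarrow> nat set \<Rightarrow> ('f, 'r, 'u) fm set" where
  "Forms L A V = {\<phi>. wf_fm L \<phi> \<and> pars \<phi> \<subseteq> A \<and> fv \<phi> \<subseteq> V}"

text \<open>
  \<open>holds S \<phi> a\<close> is \<open>S \<Turnstile> \<phi>(a)\<close>: the tuple \<open>a\<close> is assigned to the variables below \<open>length a\<close>. It is
  only meaningful if all free variables of \<open>\<phi>\<close> are below \<open>length a\<close>.
\<close>

definition holds :: "('f, 'r, 'u) struct \<Rightarrow> ('f, 'r, 'u) fm \<Rightarrow> 'u list \<Rightarrow> bool" where
  "holds S \<phi> a \<longleftrightarrow> sat S (\<lambda>i. a ! i) \<phi>"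

definition models :: "('f, 'r, 'u) struct \<Rightarrow> ('f, 'r, 'u) fm set \<Rightarrow> bool" where
  "models S T \<longleftrightarrow> (\<forall>\<phi>\<in>T. holds S \<phi> [])"

text \<open>Theories are taken to be deductively closed; consistency will come from a model.\<close>

definition complete_theory :: "('f, 'r) lang \<Rightarrow> ('f, 'r, 'u) fm set \<Rightarrow> bool" where
  "complete_theory L T \<longleftrightarrow>
     T \<subseteq> Forms L {} {} \<and> (\<forall>\<phi>\<in>Forms L {} {}. \<phi> \<in> T \<or> Neg \<phi> \<in> T)"

definition elem_sub ::
  "('f, 'r) lang \<Rightarrow> ('f, 'r, 'u) struct \<Rightarrow> ('f, 'r, 'u) struct \<Rightarrow> bool" where
  "elem_sub L M N \<longleftrightarrow>
     is_struct L M \<and> is_struct L N \<and> Dom M \<subseteq> Dom N \<and>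
     (\<forall>(f, k)\<in>Funs L. \<forall>a\<in>tuples (Dom M) k. Fint M f a = Fint N f a) \<and>
     (\<forall>(R, k)\<in>Rels L. \<forall>a\<in>tuples (Dom M) k. Rint M R a = Rint N R a) \<and>
     (\<forall>k. \<forall>\<phi>\<in>Forms L {} {..<k}. \<forall>a\<in>tuples (Dom M) k. holds M \<phi> a \<longleftrightarrow> holds N \<phi> a)"

text \<open>Complete \<open>n\<close>-types over \<open>A\<close> (in the variables below \<open>n\<close>), relative to \<open>U\<close>.\<close>

definition complete_type ::
  "('f, 'r) lang \<Rightarrow> ('f, 'r, 'u) struct \<Rightarrow> 'u set \<Rightarrow> nat \<Rightarrow> ('f, 'r, 'u) fm set \<Rightarrow> bool" where
  "complete_type L U A n p \<longleftrightarrow>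
     p \<subseteq> Forms L A {..<n} \<and>
     (\<forall>\<phi>\<in>Forms L A {..<n}. \<phi> \<in> p \<or> Neg \<phi> \<in> p) \<and>
     (\<forall>F\<subseteq>p. finite F \<longrightarrow> (\<exists>a\<in>tuples (Dom U) n. \<forall>\<phi>\<in>F. holds U \<phi> a))"

abbreviation global_type ::
  "('f, 'r) lang \<Rightarrow> ('f, 'r, 'u) struct \<Rightarrow> nat \<Rightarrow> ('f, 'r, 'u) fm set \<Rightarrow> bool" where
  "global_type L U n p \<equiv> complete_type L U (Dom U) n p"

definition restr :: "('f, 'r, 'u) fm set \<Rightarrow> 'u set \<Rightarrow> ('f, 'r, 'u) fm set" where
  "restr p B = {\<phi>\<in>p. pars \<phi> \<subseteq> B}"

definition realizes ::
  "('f, 'r, 'u) struct \<Rightarrow> nat \<Rightarrow> 'u list \<Rightarrow> ('f, 'r, 'u) fm set \<Rightarrow> bool" where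
  "realizes U n a p \<longleftrightarrow> a \<in> tuples (Dom U) n \<and> (\<forall>\<phi>\<in>p. holds U \<phi> a)"

definition automorphism ::
  "('f, 'r) lang \<Rightarrow> ('f, 'r, 'u) struct \<Rightarrow> ('u \<Rightarrow> 'u) \<Rightarrow> bool" where
  "automorphism L U \<sigma> \<longleftrightarrow>
     bij_betw \<sigma> (Dom U) (Dom U) \<and>
     (\<forall>(f, k)\<in>Funs L. \<forall>a\<in>tuples (Dom U) k. \<sigma> (Fint U f a) = Fint U f (map \<sigma> a)) \<and>
     (\<forall>(R, k)\<in>Rels L. \<forall>a\<in>tuples (Dom U) k. Rint U R a \<longleftrightarrow> Rint U R (map \<sigma> a))"

definition elementary_map ::
  "('f, 'r) lang \<Rightarrow> ('f, 'r, 'u) struct \<Rightarrow> 'u set \<Rightarrow> ('u \<Rightarrow> 'u) \<Rightarrow> bool" where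
  "elementary_map L U A h \<longleftrightarrow>
     h ` A \<subseteq> Dom U \<and>
     (\<forall>k. \<forall>\<phi>\<in>Forms L {} {..<k}. \<forall>a\<in>tuples A k. holds U \<phi> a \<longleftrightarrow> holds U \<phi> (map h a))"

definition saturated ::
  "('f, 'r) lang \<Rightarrow> 'k rel \<Rightarrow> ('f, 'r, 'u) struct \<Rightarrow> bool" where
  "saturated L \<kappa> U \<longleftrightarrow>
     (\<forall>A n p. A \<subseteq> Dom U \<and> |A| <o \<kappa> \<and> complete_type L U A n p \<longrightarrow> (\<exists>a. realizes U n a p))"

definition strongly_homogeneous ::
  "('f, 'r) lang \<Rightarrow> 'k rel \<Rightarrow> ('f, 'r, 'u) struct \<Rightarrow> bool" where
  "strongly_homogeneous L \<kappa> U \<longleftrightarrow>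
     (\<forall>A h. A \<subseteq> Dom U \<and> |A| <o \<kappa> \<and> elementary_map L U A h \<longrightarrow>
        (\<exists>\<sigma>. automorphism L U \<sigma> \<and> (\<forall>a\<in>A. \<sigma> a = h a)))"

text \<open>
  A monster model is \<open>\<kappa>\<close>-saturated and strongly \<open>\<kappa>\<close>-homogeneous for an uncountable cardinal \<open>\<kappa>\<close>
  exceeding the size of the language; \<open>small\<close> means of cardinality less than \<open>\<kappa>\<close>.
\<close>

definition monster ::
  "('f, 'r) lang \<Rightarrow> ('f, 'r, 'u) fm set \<Rightarrow> 'k rel \<Rightarrow> ('f, 'r, 'u) struct \<Rightarrow> bool" where
  "monster L T \<kappa> U \<longleftrightarrow>
     is_struct L U \<and> models U T \<and>
     Card_order \<kappa> \<and> natLeq <o \<kappa> \<and> |Funs L| <o \<kappa> \<and> |Rels L| <o \<kappa> \<and>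
     saturated L \<kappa> U \<and> strongly_homogeneous L \<kappa> U"

text \<open>\<open>p\<close> is invariant under \<open>Aut(U/A)\<close>; \<open>map_fm id id \<sigma> \<phi>\<close> is \<open>\<phi>\<close> with parameters moved by \<open>\<sigma>\<close>.\<close>

definition invariant_type ::
  "('f, 'r) lang \<Rightarrow> ('f, 'r, 'u) struct \<Rightarrow> 'u set \<Rightarrow> nat \<Rightarrow> ('f, 'r, 'u) fm set \<Rightarrow> bool" where
  "invariant_type L U A n p \<longleftrightarrow>
     (\<forall>\<sigma>. automorphism L U \<sigma> \<and> (\<forall>a\<in>A. \<sigma> a = a) \<longrightarrow>
        (\<forall>\<phi>\<in>Forms L (Dom U) {..<n}. \<phi> \<in> p \<longleftrightarrow> map_fm id id \<sigma> \<phi> \<in> p))"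

definition definable_over ::
  "('f, 'r) lang \<Rightarrow> ('f, 'r, 'u) struct \<Rightarrow> 'u set \<Rightarrow> nat \<Rightarrow> ('f, 'r, 'u) fm set \<Rightarrow> bool" where
  "definable_over L U A n p \<longleftrightarrow>
     (\<forall>k. \<forall>\<phi>\<in>Forms L {} {..<n + k}. \<exists>\<psi>\<in>Forms L A {..<k}.
        \<forall>b\<in>tuples (Dom U) k. plug n b \<phi> \<in> p \<longleftrightarrow> holds U \<psi> b)"

definition finitely_satisfiable_in ::
  "('f, 'r, 'u) struct \<Rightarrow> 'u set \<Rightarrow> nat \<Rightarrow> ('f, 'r, 'u) fm set \<Rightarrow> bool" where
  "finitely_satisfiable_in U A n p \<longleftrightarrow> (\<forall>\<phi>\<in>p. \<exists>a\<in>tuples A n. holds U \<phi> a)"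

text \<open>\<open>a \<Turnstile> p\<^sup>(\<^sup>\<omega>\<^sup>)|A\<close>.\<close>

definition morley_sequence ::
  "('f, 'r, 'u) struct \<Rightarrow> 'u set \<Rightarrow> nat \<Rightarrow> ('f, 'r, 'u) fm set \<Rightarrow> (nat \<Rightarrow> 'u list) \<Rightarrow> bool" where
  "morley_sequence U A n p a \<longleftrightarrow>
     (\<forall>i. realizes U n (a i) (restr p (A \<union> (\<Union>j<i. set (a j)))))"

definition is_limit_type ::
  "('f, 'r) lang \<Rightarrow> ('f, 'r, 'u) struct \<Rightarrow> nat \<Rightarrow> (nat \<Rightarrow> 'u list) \<Rightarrow> ('f, 'r, 'u) fm set \<Rightarrow> bool" where
  "is_limit_type L U n a p \<longleftrightarrow>
     (\<forall>\<phi>\<in>Forms L (Dom U) {..<n}. \<phi> \<in> p \<longleftrightarrow> (\<forall>\<^sub>F i in sequentially. holds U \<phi> (a i)))"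

text \<open>
  The Morley product \<open>p\<^sub>x \<otimes> q\<^sub>y\<close> of \<open>A\<close>-invariant types, as a global type in the variables \<open>x, y\<close>;
  \<open>xs\<close> and \<open>ys\<close> list the variables of the tuples \<open>x\<close> and \<open>y\<close> (distinct and disjoint), and an
  assignment \<open>e\<close> gives the tuples \<open>a = e(x)\<close> and \<open>b = e(y)\<close>. A formula over a small \<open>B \<supseteq> A\<close> belongs
  to the product iff it holds of \<open>(a, b)\<close> whenever \<open>b \<Turnstile> q|B\<close> and \<open>a \<Turnstile> p|Bb\<close>.
\<close>

definition morley_product ::
  "('f, 'r) lang \<Rightarrow> 'k rel \<Rightarrow> ('f, 'r, 'u) struct \<Rightarrow> 'u set \<Rightarrow>
   nat list \<Rightarrow> ('f, 'r, 'u) fm set \<Rightarrow> nat list \<Rightarrow> ('f, 'r, 'u) fm set \<Rightarrow> ('f, 'r, 'u) fm set" where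
  "morley_product L \<kappa> U A xs p ys q =
     {\<theta> \<in> Forms L (Dom U) (set xs \<union> set ys).
        \<forall>B e. A \<union> pars \<theta> \<subseteq> B \<and> B \<subseteq> Dom U \<and> |B| <o \<kappa> \<and>
              realizes U (length ys) (map e ys) (restr q B) \<and>
              realizes U (length xs) (map e xs) (restr p (B \<union> e ` set ys))
          \<longrightarrow> sat U e \<theta>}"

definition totally_indiscernible ::
  "('f, 'r) lang \<Rightarrow> ('f, 'r, 'u) struct \<Rightarrow> 'u set \<Rightarrow> nat \<Rightarrow> (nat \<Rightarrow> 'u list) \<Rightarrow> bool" where
  "totally_indiscernible L U A n a \<longleftrightarrow>
     (\<forall>k. \<forall>\<phi>\<in>Forms L A {..<k * n}. \<forall>is js.
        length is = k \<and> distinct is \<and> length js = k \<and> distinct js \<longrightarrow>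
        (holds U \<phi> (concat (map a is)) \<longleftrightarrow> holds U \<phi> (concat (map a js))))"

text \<open>
  Eventual NIP of \<open>\<phi>(x, y)\<close>, where \<open>x\<close> consists of the first \<open>m\<close> variables and \<open>y\<close> of the next \<open>k\<close>;
  the subsequence is \<open>c \<circ> r\<close>.
\<close>

definition eventually_NIP_fm ::
  "('f, 'r, 'u) struct \<Rightarrow> 'u set \<Rightarrow> nat \<Rightarrow> nat \<Rightarrow> ('f, 'r, 'u) fm \<Rightarrow> bool" where
  "eventually_NIP_fm U A m k \<phi> \<longleftrightarrow>
     (\<forall>c :: nat \<Rightarrow> 'u list. (\<forall>i. c i \<in> tuples A m) \<longrightarrow>
        (\<exists>(r :: nat \<Rightarrow> nat) (n :: nat) E. strict_mono r \<and> E \<subseteq> {1..n} \<and>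
           (\<forall>i :: nat \<Rightarrow> nat. strict_mono_on {1..n} i \<longrightarrow>
              \<not> (\<exists>b\<in>tuples (Dom U) k.
                   (\<forall>j\<in>E. holds U \<phi> (c (r (i j)) @ b)) \<and>
                   (\<forall>j\<in>{1..n} - E. \<not> holds U \<phi> (c (r (i j)) @ b))))))"

definition eventually_NIP ::
  "('f, 'r) lang \<Rightarrow> ('f, 'r, 'u) struct \<Rightarrow> 'u set \<Rightarrow> bool" where
  "eventually_NIP L U A \<longleftrightarrow>
     (\<forall>m k. \<forall>\<phi>\<in>Forms L (Dom U) {..<m + k}. eventually_NIP_fm U A m k \<phi>)"

end

theory Submission
  imports Defs
begin

text \<open>
  (i) implies (ii): let \<open>p\<close> be the limit of the Morley sequence \<open>(a\<^sub>i)\<close> and \<open>F(x, b) \<in> p\<close>. If every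
  \<open>\<chi> \<in> tp(b/M)\<close> held of some \<open>b'\<close> with \<open>F(x, b') \<notin> p\<close>, compactness would give \<open>b'' \<equiv>\<^sub>M b\<close> with all
  \<open>F(a\<^sub>i, b'')\<close> false, so \<open>F(x, b'') \<notin> p\<close>, against invariance. Hence \<open>{y. F(x, y) \<in> p}\<close> is a union
  of \<open>M\<close>-definable sets, and so is its complement; by compactness it is \<open>M\<close>-definable. Compactness
  also bounds the number of \<open>a\<^sub>i\<close> needed to satisfy some \<open>F(a\<^sub>i, y)\<close> for all these \<open>y\<close>, and by
  elementarity the \<open>a\<^sub>i\<close> can be replaced by tuples of \<open>M\<close>. (ii) implies (iii) is the commutation of
  definable with finitely satisfiable types. Under (iii), neighbours in a finite Morley sequence may
  be swapped, which gives (iv). Finally, if (iv) holds and infinitely many \<open>a\<^sub>i\<close> violate some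
  \<open>F(x, b) \<in> p\<close>, these followed by a Morley sequence over everything realize every pattern of truth
  values, contradicting eventual NIP.
\<close>

section \<open>Syntax and satisfaction\<close>

text \<open>Formulas with named variables are awkward to manipulate, so most of the work is done
  with predicates on tuples: \<open>definable A k P\<close> says that some formula over
  \<open>A\<close> defines \<open>P\<close>, and \<open>in_type P\<close> that some formula defining
  \<open>P\<close> lies in \<open>p\<close>.

  The obstacle in (iv) implies (i) is that eventual NIP concerns only sequences lying in
  \<open>M'\<close>, whereas the offending sequence and the parameter \<open>b\<close> may lie
  anywhere in \<open>U\<close>. What does pass to the given Morley sequence in \<open>M'\<close> is
  the formula saying that some \<open>y\<close> produces a prescribed pattern of truth values: it is
  over \<open>M\<close>, and finite pieces of Morley sequences of \<open>p\<close> over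
  \<open>M\<close> have the same type over \<open>M\<close>. The parameter is thus quantified away.
  The same transfer, with a constant pattern, yields the finitely many failures needed in (i)
  implies (ii).

  Invariance enters through the consequence that membership of \<open>F(x, b)\<close> in
  \<open>p\<close> depends only on the type of \<open>b\<close> over \<open>M\<close>. Homogeneity
  of the monster model provides the automorphisms for this, and saturation provides
  compactness.\<close>

lemma eval_cong: "(\<And>i. i \<in> fv_tm t \<Longrightarrow> e i = e' i) \<Longrightarrow> eval S e t = eval S e' t"
proof (induction t)
  case (Fn f ts)
  then have "map (eval S e) ts = map (eval S e') ts" by auto
  then show ?case by (simp del: map_eq_conv)
qed auto

lemma sat_cong: "(\<And>i. i \<in> fv \<phi> \<Longrightarrow> e i = e' i) \<Longrightarrow> sat S e \<phi> = sat S e' \<phi>"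
proof (induction \<phi> arbitrary: e e')
  case (Eq s t)
  then have "eval S e s = eval S e' s" "eval S e t = eval S e' t"
    by (auto intro: eval_cong)
  then show ?case by simp
next
  case (Rel R ts)
  then have "map (eval S e) ts = map (eval S e') ts"
    by (auto intro!: eval_cong)
  then show ?case by (simp del: map_eq_conv)
next
  case (Neg \<phi>)
  then show ?case by (metis fv.simps(3) sat.simps(3))
next
  case (Conj \<phi> \<psi>)
  have "sat S e \<phi> = sat S e' \<phi>" "sat S e \<psi> = sat S e' \<psi>"
    using Conj.prems by (auto intro!: Conj.IH)
  then show ?case by simp
next
  case (Ex i \<phi>)
  have "sat S (e(i := u)) \<phi> = sat S (e'(i := u)) \<phi>" for u
    using Ex.prems by (intro Ex.IH) auto
  then show ?case by simp
qed

lemma finite_fv_tm: "finite (fv_tm t)"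
  by (induction t) auto

lemma finite_fv: "finite (fv \<phi>)"
  by (induction \<phi>) (auto simp: finite_fv_tm)

lemma finite_tpars: "finite (tpars t)"
  by (induction t) auto

lemma finite_pars: "finite (pars \<phi>)"
  by (induction \<phi>) (auto simp: finite_tpars)

section \<open>Instantiation of free variables by parameters\<close>

lemma eval_inst: "eval S e (inst_tm s t) = eval S (\<lambda>i. case s i of None \<Rightarrow> e i | Some a \<Rightarrow> a) t"
  by (induction t) (auto split: option.splits simp: comp_def cong: map_cong)

lemma sat_inst: "sat S e (inst s \<phi>) = sat S (\<lambda>i. case s i of None \<Rightarrow> e i | Some a \<Rightarrow> a) \<phi>"
proof (induction \<phi> arbitrary: e s)
  case (Ex i \<phi>)
  have "(\<lambda>j. case (s(i := None)) j of None \<Rightarrow> (e(i := u)) j | Some a \<Rightarrow> a) =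
    (\<lambda>j. case s j of None \<Rightarrow> e j | Some a \<Rightarrow> a)(i := u)" for u
    by (auto simp: fun_eq_iff split: option.split)
  then show ?case by (simp add: Ex.IH del: fun_upd_apply)
qed (auto simp: eval_inst comp_def)

lemma wf_inst_tm: "wf_tm L (inst_tm s t) = wf_tm L t"
  by (induction t) (auto split: option.splits)

lemma wf_inst: "wf_fm L (inst s \<phi>) = wf_fm L \<phi>"
  by (induction \<phi> arbitrary: s) (auto simp: wf_inst_tm)

lemma fv_inst_tm: "fv_tm (inst_tm s t) = fv_tm t - dom s"
  by (induction t) (auto split: option.splits)

lemma fv_inst: "fv (inst s \<phi>) = fv \<phi> - dom s"
  by (induction \<phi> arbitrary: s) (auto simp: fv_inst_tm)

lemma pars_inst_tm: "tpars (inst_tm s t) \<subseteq> tpars t \<union> ran s"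
  by (induction t) (auto split: option.splits simp: ran_def)

lemma pars_inst: "pars (inst s \<phi>) \<subseteq> pars \<phi> \<union> ran s"
proof (induction \<phi> arbitrary: s)
  case (Ex i \<phi>)
  have "ran (s(i := None)) \<subseteq> ran s" by (auto simp: ran_def)
  with Ex.IH[of "s(i := None)"] show ?case by (simp del: fun_upd_apply) blast
next
  case (Rel R ts)
  then show ?case using pars_inst_tm by fastforce
next
  case (Eq t u)
  then show ?case using pars_inst_tm by fastforce
qed fastforce+

text \<open>Parameters are replaced along with variables so that one statement covers both
  directions: putting constants in for variables, and turning constants back into variables. The
  condition \<open>eval S e (h a) = a\<close> is imposed for each assignment because
  \<open>h a\<close> may be a variable that denotes \<open>a\<close> only under suitable
  \<open>e\<close>.\<close>

lemma tm_subst: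
  assumes "wf_tm L t" "\<And>i. i \<in> fv_tm t \<Longrightarrow> wf_tm L (s i)" "\<And>a. a \<in> tpars t \<Longrightarrow> wf_tm L (h a)"
  shows "\<exists>t'. wf_tm L t' \<and> fv_tm t' \<subseteq> (\<Union>i\<in>fv_tm t. fv_tm (s i)) \<union> (\<Union>a\<in>tpars t. fv_tm (h a)) \<and>
    tpars t' \<subseteq> (\<Union>i\<in>fv_tm t. tpars (s i)) \<union> (\<Union>a\<in>tpars t. tpars (h a)) \<and>
    (\<forall>e. (\<forall>a\<in>tpars t. eval S e (h a) = a) \<longrightarrow> eval S e t' = eval S (\<lambda>i. eval S e (s i)) t)"
  using assms
proof (induction t)
  case (Var i)
  then show ?case by (intro exI[of _ "s i"]) auto
next
  case (Par a)
  then show ?case by (intro exI[of _ "h a"]) auto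
next
  case (Fn f ts)
  have "\<exists>t'. wf_tm L t' \<and> fv_tm t' \<subseteq> (\<Union>i\<in>fv_tm t. fv_tm (s i)) \<union> (\<Union>a\<in>tpars t. fv_tm (h a)) \<and>
    tpars t' \<subseteq> (\<Union>i\<in>fv_tm t. tpars (s i)) \<union> (\<Union>a\<in>tpars t. tpars (h a)) \<and>
    (\<forall>e. (\<forall>a\<in>tpars t. eval S e (h a) = a) \<longrightarrow> eval S e t' = eval S (\<lambda>i. eval S e (s i)) t)"
    if "t \<in> set ts" for t
    using that Fn.prems by (intro Fn.IH) auto
  then obtain g where g1: "\<And>t. t \<in> set ts \<Longrightarrow> wf_tm L (g t)"
    and g2: "\<And>t. t \<in> set ts \<Longrightarrow>
      fv_tm (g t) \<subseteq> (\<Union>i\<in>fv_tm t. fv_tm (s i)) \<union> (\<Union>a\<in>tpars t. fv_tm (h a))"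
    and g3: "\<And>t. t \<in> set ts \<Longrightarrow>
      tpars (g t) \<subseteq> (\<Union>i\<in>fv_tm t. tpars (s i)) \<union> (\<Union>a\<in>tpars t. tpars (h a))"
    and g4: "\<And>t e. t \<in> set ts \<Longrightarrow> \<forall>a\<in>tpars t. eval S e (h a) = a \<Longrightarrow>
      eval S e (g t) = eval S (\<lambda>i. eval S e (s i)) t"
    by metis
  show ?case
  proof (intro exI[of _ "Fn f (map g ts)"] conjI allI impI)
    show "wf_tm L (Fn f (map g ts))" using Fn.prems g1 by auto
    show "fv_tm (Fn f (map g ts)) \<subseteq>
      (\<Union>i\<in>fv_tm (Fn f ts). fv_tm (s i)) \<union> (\<Union>a\<in>tpars (Fn f ts). fv_tm (h a))"
      proof -
      have "fv_tm (g t) \<subseteq> (\<Union>i\<in>fv_tm (Fn f ts). fv_tm (s i)) \<union> (\<Union>a\<in>tpars (Fn f ts). fv_tm (h a))"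
        if "t \<in> set ts" for t
        by (rule subset_trans[OF g2[OF that]]) (use that in auto)
      then show ?thesis by auto
    qed
    show "tpars (Fn f (map g ts)) \<subseteq>
      (\<Union>i\<in>fv_tm (Fn f ts). tpars (s i)) \<union> (\<Union>a\<in>tpars (Fn f ts). tpars (h a))"
      proof -
      have "tpars (g t) \<subseteq> (\<Union>i\<in>fv_tm (Fn f ts). tpars (s i)) \<union> (\<Union>a\<in>tpars (Fn f ts). tpars (h a))"
        if "t \<in> set ts" for t
        by (rule subset_trans[OF g3[OF that]]) (use that in auto)
      then show ?thesis by auto
    qed
    fix e assume *: "\<forall>a\<in>tpars (Fn f ts). eval S e (h a) = a"
    have "map (eval S e) (map g ts) = map (eval S (\<lambda>i. eval S e (s i))) ts"
      using g4 * by simp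
    then show "eval S e (Fn f (map g ts)) = eval S (\<lambda>i. eval S e (s i)) (Fn f ts)"
      by (simp del: map_map map_eq_conv)
  qed
qed

text \<open>Capture-avoiding substitution, simultaneously of terms \<open>s\<close> for the free variables and of
  terms \<open>h\<close> for the parameters. Fresh bound variables make this a choice, whence the
  existential form.\<close>

lemma fm_subst:
  assumes "wf_fm L \<phi>" "\<And>i. i \<in> fv \<phi> \<Longrightarrow> wf_tm L (s i)" "\<And>a. a \<in> pars \<phi> \<Longrightarrow> wf_tm L (h a)"
  shows "\<exists>\<psi>. wf_fm L \<psi> \<and> fv \<psi> \<subseteq> (\<Union>i\<in>fv \<phi>. fv_tm (s i)) \<union> (\<Union>a\<in>pars \<phi>. fv_tm (h a)) \<and>
    pars \<psi> \<subseteq> (\<Union>i\<in>fv \<phi>. tpars (s i)) \<union> (\<Union>a\<in>pars \<phi>. tpars (h a)) \<and>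
    (\<forall>e. (\<forall>a\<in>pars \<phi>. eval S e (h a) = a) \<longrightarrow> sat S e \<psi> = sat S (\<lambda>i. eval S e (s i)) \<phi>)"
  using assms
proof (induction \<phi> arbitrary: s)
  case (Eq t u)
  obtain t' where "wf_tm L t'" "fv_tm t' \<subseteq> (\<Union>i\<in>fv_tm t. fv_tm (s i)) \<union> (\<Union>a\<in>tpars t. fv_tm (h a))"
    "tpars t' \<subseteq> (\<Union>i\<in>fv_tm t. tpars (s i)) \<union> (\<Union>a\<in>tpars t. tpars (h a))"
    "\<forall>e. (\<forall>a\<in>tpars t. eval S e (h a) = a) \<longrightarrow> eval S e t' = eval S (\<lambda>i. eval S e (s i)) t"
    by (atomize_elim, rule tm_subst) (use Eq.prems in auto)
  moreover obtain u' where "wf_tm L u'"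
    "fv_tm u' \<subseteq> (\<Union>i\<in>fv_tm u. fv_tm (s i)) \<union> (\<Union>a\<in>tpars u. fv_tm (h a))"
    "tpars u' \<subseteq> (\<Union>i\<in>fv_tm u. tpars (s i)) \<union> (\<Union>a\<in>tpars u. tpars (h a))"
    "\<forall>e. (\<forall>a\<in>tpars u. eval S e (h a) = a) \<longrightarrow> eval S e u' = eval S (\<lambda>i. eval S e (s i)) u"
    by (atomize_elim, rule tm_subst) (use Eq.prems in auto)
  ultimately show ?case by (intro exI[of _ "Eq t' u'"]) auto
next
  case (Rel R ts)
  have "\<forall>t\<in>set ts. \<exists>t'. wf_tm L t' \<and>
    fv_tm t' \<subseteq> (\<Union>i\<in>fv_tm t. fv_tm (s i)) \<union> (\<Union>a\<in>tpars t. fv_tm (h a)) \<and>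
    tpars t' \<subseteq> (\<Union>i\<in>fv_tm t. tpars (s i)) \<union> (\<Union>a\<in>tpars t. tpars (h a)) \<and>
    (\<forall>e. (\<forall>a\<in>tpars t. eval S e (h a) = a) \<longrightarrow> eval S e t' = eval S (\<lambda>i. eval S e (s i)) t)"
    using Rel.prems by (intro ballI tm_subst) auto
  then obtain g where g1: "\<And>t. t \<in> set ts \<Longrightarrow> wf_tm L (g t)"
    and g2: "\<And>t. t \<in> set ts \<Longrightarrow>
      fv_tm (g t) \<subseteq> (\<Union>i\<in>fv_tm t. fv_tm (s i)) \<union> (\<Union>a\<in>tpars t. fv_tm (h a))"
    and g3: "\<And>t. t \<in> set ts \<Longrightarrow>
      tpars (g t) \<subseteq> (\<Union>i\<in>fv_tm t. tpars (s i)) \<union> (\<Union>a\<in>tpars t. tpars (h a))"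
    and g4: "\<And>t e. t \<in> set ts \<Longrightarrow> \<forall>a\<in>tpars t. eval S e (h a) = a \<Longrightarrow>
      eval S e (g t) = eval S (\<lambda>i. eval S e (s i)) t"
    by metis
  show ?case
  proof (intro exI[of _ "Rel R (map g ts)"] conjI allI impI)
    show "wf_fm L (Rel R (map g ts))" using Rel.prems g1 by auto
    show "fv (Rel R (map g ts)) \<subseteq>
      (\<Union>i\<in>fv (Rel R ts). fv_tm (s i)) \<union> (\<Union>a\<in>pars (Rel R ts). fv_tm (h a))"
      proof -
      have "fv_tm (g t) \<subseteq> (\<Union>i\<in>fv (Rel R ts). fv_tm (s i)) \<union> (\<Union>a\<in>pars (Rel R ts). fv_tm (h a))"
        if "t \<in> set ts" for t
        by (rule subset_trans[OF g2[OF that]]) (use that in auto)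
      then show ?thesis by auto
    qed
    show "pars (Rel R (map g ts)) \<subseteq>
      (\<Union>i\<in>fv (Rel R ts). tpars (s i)) \<union> (\<Union>a\<in>pars (Rel R ts). tpars (h a))"
      proof -
      have "tpars (g t) \<subseteq> (\<Union>i\<in>fv (Rel R ts). tpars (s i)) \<union> (\<Union>a\<in>pars (Rel R ts). tpars (h a))"
        if "t \<in> set ts" for t
        by (rule subset_trans[OF g3[OF that]]) (use that in auto)
      then show ?thesis by auto
    qed
    fix e assume *: "\<forall>a\<in>pars (Rel R ts). eval S e (h a) = a"
    have "map (eval S e) (map g ts) = map (eval S (\<lambda>i. eval S e (s i))) ts"
      using g4 * by simp
    then show "sat S e (Rel R (map g ts)) = sat S (\<lambda>i. eval S e (s i)) (Rel R ts)"
      by (simp del: map_map map_eq_conv)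
  qed
next
  case (Neg \<phi>)
  obtain \<psi> where "wf_fm L \<psi>" "fv \<psi> \<subseteq> (\<Union>i\<in>fv \<phi>. fv_tm (s i)) \<union> (\<Union>a\<in>pars \<phi>. fv_tm (h a))"
    "pars \<psi> \<subseteq> (\<Union>i\<in>fv \<phi>. tpars (s i)) \<union> (\<Union>a\<in>pars \<phi>. tpars (h a))"
    "\<forall>e. (\<forall>a\<in>pars \<phi>. eval S e (h a) = a) \<longrightarrow> sat S e \<psi> = sat S (\<lambda>i. eval S e (s i)) \<phi>"
    by (atomize_elim, rule Neg.IH) (use Neg.prems in auto)
  then show ?case by (intro exI[of _ "Neg \<psi>"]) simp
next
  case (Conj \<phi> \<psi>)
  obtain \<phi>' where "wf_fm L \<phi>'" "fv \<phi>' \<subseteq> (\<Union>i\<in>fv \<phi>. fv_tm (s i)) \<union> (\<Union>a\<in>pars \<phi>. fv_tm (h a))"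
    "pars \<phi>' \<subseteq> (\<Union>i\<in>fv \<phi>. tpars (s i)) \<union> (\<Union>a\<in>pars \<phi>. tpars (h a))"
    "\<forall>e. (\<forall>a\<in>pars \<phi>. eval S e (h a) = a) \<longrightarrow> sat S e \<phi>' = sat S (\<lambda>i. eval S e (s i)) \<phi>"
    by (atomize_elim, rule Conj.IH(1)) (use Conj.prems in auto)
  moreover obtain \<psi>' where "wf_fm L \<psi>'"
    "fv \<psi>' \<subseteq> (\<Union>i\<in>fv \<psi>. fv_tm (s i)) \<union> (\<Union>a\<in>pars \<psi>. fv_tm (h a))"
    "pars \<psi>' \<subseteq> (\<Union>i\<in>fv \<psi>. tpars (s i)) \<union> (\<Union>a\<in>pars \<psi>. tpars (h a))"
    "\<forall>e. (\<forall>a\<in>pars \<psi>. eval S e (h a) = a) \<longrightarrow> sat S e \<psi>' = sat S (\<lambda>i. eval S e (s i)) \<psi>"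
    by (atomize_elim, rule Conj.IH(2)) (use Conj.prems in auto)
  ultimately show ?case by (intro exI[of _ "Conj \<phi>' \<psi>'"]) auto
next
  case (Ex i \<phi>)
  \<comment> \<open>The new bound variable must avoid every variable that \<open>s\<close> or
    \<open>h\<close> brings in from outside the quantifier. The term \<open>s i\<close> does not
    count, because \<open>s\<close> is overridden at \<open>i\<close>.\<close>
  define V where "V = (\<Union>l\<in>fv \<phi> - {i}. fv_tm (s l)) \<union> (\<Union>a\<in>pars \<phi>. fv_tm (h a))"
  have "finite V" by (auto simp: V_def finite_fv finite_fv_tm finite_pars)
  then obtain j where j: "j \<notin> V" using ex_new_if_finite infinite_UNIV_nat by blast
  obtain \<psi> where \<psi>: "wf_fm L \<psi>"
    "fv \<psi> \<subseteq> (\<Union>l\<in>fv \<phi>. fv_tm ((s(i := Var j)) l)) \<union> (\<Union>a\<in>pars \<phi>. fv_tm (h a))"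
    "pars \<psi> \<subseteq> (\<Union>l\<in>fv \<phi>. tpars ((s(i := Var j)) l)) \<union> (\<Union>a\<in>pars \<phi>. tpars (h a))"
    "\<forall>e. (\<forall>a\<in>pars \<phi>. eval S e (h a) = a) \<longrightarrow>
      sat S e \<psi> = sat S (\<lambda>l. eval S e ((s(i := Var j)) l)) \<phi>"
    by (atomize_elim, rule Ex.IH) (use Ex.prems in \<open>auto split: if_splits\<close>)
  show ?case
  proof (intro exI[of _ "Ex j \<psi>"] conjI allI impI)
    show "wf_fm L (Ex j \<psi>)" using \<psi> by simp
    show "fv (Ex j \<psi>) \<subseteq>
      (\<Union>l\<in>fv (Ex i \<phi>). fv_tm (s l)) \<union> (\<Union>a\<in>pars (Ex i \<phi>). fv_tm (h a))"
      by (auto dest!: subsetD[OF \<psi>(2)] split: if_splits)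
    show "pars (Ex j \<psi>) \<subseteq>
      (\<Union>l\<in>fv (Ex i \<phi>). tpars (s l)) \<union> (\<Union>a\<in>pars (Ex i \<phi>). tpars (h a))"
      by (auto dest!: subsetD[OF \<psi>(3)] split: if_splits)
    fix e assume *: "\<forall>a\<in>pars (Ex i \<phi>). eval S e (h a) = a"
    have "sat S (e(j := u)) \<psi> = sat S ((\<lambda>i. eval S e (s i))(i := u)) \<phi>" for u
    proof -
      have "\<forall>a\<in>pars \<phi>. eval S (e(j := u)) (h a) = a"
      proof
        fix a assume a: "a \<in> pars \<phi>"
        then have "eval S (e(j := u)) (h a) = eval S e (h a)"
          using j by (intro eval_cong) (auto simp: V_def)
        then show "eval S (e(j := u)) (h a) = a" using * a by simp
      qed
      then have "sat S (e(j := u)) \<psi> = sat S (\<lambda>l. eval S (e(j := u)) ((s(i := Var j)) l)) \<phi>"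
        by (rule \<psi>(4)[THEN spec, THEN mp])
      also have "\<dots> = sat S ((\<lambda>i. eval S e (s i))(i := u)) \<phi>"
        using j by (intro sat_cong) (auto simp: V_def intro!: eval_cong)
      finally show ?thesis .
    qed
    then show "sat S e (Ex j \<psi>) = sat S (\<lambda>i. eval S e (s i)) (Ex i \<phi>)" by simp
  qed
qed

section \<open>Automorphisms preserve satisfaction\<close>

lemma eval_in_Dom:
  assumes "is_struct L S" "wf_tm L t" "tpars t \<subseteq> Dom S" "\<And>i. i \<in> fv_tm t \<Longrightarrow> e i \<in> Dom S"
  shows "eval S e t \<in> Dom S"
  using assms(2-)
proof (induction t)
  case (Fn f ts)
  have "eval S e t \<in> Dom S" if "t \<in> set ts" for t
    using that Fn.prems by (intro Fn.IH) auto
  then have "map (eval S e) ts \<in> tuples (Dom S) (length ts)"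
    by (auto simp: tuples_def)
  then show ?case using assms(1) Fn.prems by (auto simp: is_struct_def)
qed auto

lemma eval_automorphism:
  assumes "is_struct L S" "automorphism L S \<sigma>"
    and "wf_tm L t" "tpars t \<subseteq> Dom S" "\<And>i. i \<in> fv_tm t \<Longrightarrow> e i \<in> Dom S"
  shows "eval S (\<lambda>i. \<sigma> (e i)) (map_tm (\<lambda>f. f) \<sigma> t) = \<sigma> (eval S e t)"
  using assms(3-)
proof (induction t)
  case (Fn f ts)
  have *: "eval S (\<lambda>i. \<sigma> (e i)) (map_tm (\<lambda>f. f) \<sigma> t) = \<sigma> (eval S e t)" if "t \<in> set ts" for t
    using that Fn.prems by (intro Fn.IH) auto
  have "map (eval S (\<lambda>i. \<sigma> (e i))) (map (map_tm (\<lambda>f. f) \<sigma>) ts) = map \<sigma> (map (eval S e) ts)"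
    using * by simp
  moreover have "map (eval S e) ts \<in> tuples (Dom S) (length ts)"
    using Fn.prems by (auto simp: tuples_def intro!: eval_in_Dom[OF assms(1)])
  ultimately show ?case using assms(2) Fn.prems
    by (auto simp: automorphism_def simp del: map_map)
qed auto

lemma fv_tm_map: "fv_tm (map_tm (\<lambda>f. f) \<sigma> t) = fv_tm t"
  by (induction t) auto

lemma fv_map: "fv (map_fm id id \<sigma> \<phi>) = fv \<phi>"
  unfolding id_def by (induction \<phi>) (auto simp: fv_tm_map)

lemma wf_tm_map: "wf_tm L (map_tm (\<lambda>f. f) \<sigma> t) = wf_tm L t"
  by (induction t) auto

lemma wf_map: "wf_fm L (map_fm id id \<sigma> \<phi>) = wf_fm L \<phi>"
  unfolding id_def by (induction \<phi>) (auto simp: wf_tm_map)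

text \<open>Injectivity of \<open>\<sigma>\<close> settles equations, and surjectivity settles
  quantifiers, whose witnesses may be taken of the form \<open>\<sigma> u\<close>. Parameters move
  together with the assignment, so none of them has to be fixed.\<close>

lemma sat_automorphism:
  assumes S: "is_struct L S" "automorphism L S \<sigma>"
    and "wf_fm L \<phi>" "pars \<phi> \<subseteq> Dom S" "\<And>i. i \<in> fv \<phi> \<Longrightarrow> e i \<in> Dom S"
  shows "sat S (\<lambda>i. \<sigma> (e i)) (map_fm id id \<sigma> \<phi>) = sat S e \<phi>"
  using assms(3-) unfolding id_def
proof (induction \<phi> arbitrary: e)
  case (Eq s t)
  have "inj_on \<sigma> (Dom S)" using S by (auto simp: automorphism_def bij_betw_def)
  moreover have "eval S e s \<in> Dom S" "eval S e t \<in> Dom S"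
    using Eq by (auto intro!: eval_in_Dom[OF S(1)])
  moreover have "eval S (\<lambda>i. \<sigma> (e i)) (map_tm (\<lambda>f. f) \<sigma> s) = \<sigma> (eval S e s)"
    "eval S (\<lambda>i. \<sigma> (e i)) (map_tm (\<lambda>f. f) \<sigma> t) = \<sigma> (eval S e t)"
    using Eq by (auto intro!: eval_automorphism[OF S])
  ultimately show ?case by (simp add: inj_on_eq_iff)
next
  case (Rel R ts)
  have "map (eval S (\<lambda>i. \<sigma> (e i))) (map (map_tm (\<lambda>f. f) \<sigma>) ts) = map \<sigma> (map (eval S e) ts)"
    using Rel by (auto intro!: eval_automorphism[OF S])
  moreover have "map (eval S e) ts \<in> tuples (Dom S) (length ts)"
    using Rel by (auto simp: tuples_def intro!: eval_in_Dom[OF S(1)])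
  ultimately show ?case using S(2) Rel.prems
    by (auto simp: automorphism_def simp del: map_map)
next
  case (Ex i \<phi>)
  have \<sigma>: "\<sigma> ` Dom S = Dom S" using S by (auto simp: automorphism_def bij_betw_def)
  have "(\<lambda>i. \<sigma> (e i))(i := \<sigma> u) = (\<lambda>l. \<sigma> ((e(i := u)) l))" for u by auto
  moreover have "sat S (\<lambda>l. \<sigma> ((e(i := u)) l)) (map_fm (\<lambda>f. f) (\<lambda>r. r) \<sigma> \<phi>) = sat S (e(i := u)) \<phi>"
    if "u \<in> Dom S" for u
    using Ex.prems that by (intro Ex.IH) auto
  ultimately have "(\<exists>u\<in>\<sigma> ` Dom S. sat S ((\<lambda>i. \<sigma> (e i))(i := u)) (map_fm (\<lambda>f. f) (\<lambda>r. r) \<sigma> \<phi>)) \<longleftrightarrow>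
    (\<exists>u\<in>Dom S. sat S (e(i := u)) \<phi>)" by auto
  then show ?case by (simp add: \<sigma>)
qed auto

section \<open>Definable predicates\<close>

lemma tuples_append: "a \<in> tuples A k \<Longrightarrow> b \<in> tuples A m \<Longrightarrow> a @ b \<in> tuples A (k + m)"
  by (auto simp: tuples_def)

lemma length_tuples: "a \<in> tuples A k \<Longrightarrow> length a = k"
  by (simp add: tuples_def)

lemma nth_tuples: "a \<in> tuples A k \<Longrightarrow> i < k \<Longrightarrow> a ! i \<in> A"
  by (auto simp: tuples_def)

lemma tuples_mono: "A \<subseteq> B \<Longrightarrow> a \<in> tuples A k \<Longrightarrow> a \<in> tuples B k"
  by (auto simp: tuples_def)

lemma tuples_Suc_iff: "z \<in> tuples A (Suc m) \<longleftrightarrow> (\<exists>b\<in>tuples A m. \<exists>u\<in>A. z = b @ [u])"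
  by (cases z rule: rev_cases) (auto simp: tuples_def)

lemma sat_eq_holds:
  assumes "fv \<phi> \<subseteq> {..<k}" "\<And>i. i < k \<Longrightarrow> e i = a ! i"
  shows "sat S e \<phi> = holds S \<phi> a"
  using assms unfolding holds_def by (intro sat_cong) auto

lemma holds_Ex:
  assumes "fv \<phi> \<subseteq> {..<Suc k}" "length a = k"
  shows "holds S (Ex k \<phi>) a \<longleftrightarrow> (\<exists>u\<in>Dom S. holds S \<phi> (a @ [u]))"
proof -
  have "sat S ((\<lambda>i. a ! i)(k := u)) \<phi> = holds S \<phi> (a @ [u])" for u
    using assms by (intro sat_eq_holds[of _ "Suc k"]) (auto simp: nth_append)
  then show ?thesis by (simp add: holds_def)
qed

lemma holds_Neg [simp]: "holds S (Neg \<phi>) a \<longleftrightarrow> \<not> holds S \<phi> a"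
  by (simp add: holds_def)

lemma holds_Conj [simp]: "holds S (Conj \<phi> \<psi>) a \<longleftrightarrow> holds S \<phi> a \<and> holds S \<psi> a"
  by (simp add: holds_def)

lemma Forms_Neg [simp]: "Neg \<phi> \<in> Forms L A V \<longleftrightarrow> \<phi> \<in> Forms L A V"
  by (simp add: Forms_def)

lemma Forms_mono: "\<phi> \<in> Forms L A V \<Longrightarrow> A \<subseteq> B \<Longrightarrow> \<phi> \<in> Forms L B V"
  by (auto simp: Forms_def)

lemma Forms_Ex: "\<phi> \<in> Forms L A {..<Suc k} \<Longrightarrow> Ex k \<phi> \<in> Forms L A {..<k}"
  by (auto simp: Forms_def)

lemma plug_Forms:
  assumes "\<phi> \<in> Forms L A {..<n + k}" "b \<in> tuples B k"
  shows "plug n b \<phi> \<in> Forms L (A \<union> B) {..<n}"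
proof -
  define s where "s = (\<lambda>i. if n \<le> i \<and> i < n + length b then Some (b ! (i - n)) else None)"
  have "ran s \<subseteq> B"
  proof
    fix x assume "x \<in> ran s"
    then obtain i where "s i = Some x" by (auto simp: ran_def)
    then have "i - n < k" "x = b ! (i - n)"
      using length_tuples[OF assms(2)] by (auto simp: s_def split: if_splits)
    then show "x \<in> B" using nth_tuples[OF assms(2)] by blast
  qed
  moreover have "i < n" if "i \<in> fv \<phi> - dom s" for i
  proof -
    have "i < n + k" "s i = None" using that assms(1) by (auto simp: Forms_def dom_def)
    then show ?thesis using length_tuples[OF assms(2)] by (simp add: s_def split: if_splits)
  qed
  moreover have "plug n b \<phi> = inst s \<phi>" by (simp add: plug_def s_def)
  ultimately show ?thesis using assms(1) pars_inst[of s \<phi>]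
    unfolding Forms_def by (simp add: wf_inst fv_inst subset_iff) blast
qed

lemma holds_plug:
  assumes "fv \<phi> \<subseteq> {..<n + k}" "length a = n" "length b = k"
  shows "holds S (plug n b \<phi>) a = holds S \<phi> (a @ b)"
proof -
  have "sat S (\<lambda>i. case if n \<le> i \<and> i < n + length b then Some (b ! (i - n)) else None of
      None \<Rightarrow> a ! i | Some c \<Rightarrow> c) \<phi> = holds S \<phi> (a @ b)"
    using assms by (intro sat_eq_holds[of _ "n + k"]) (auto simp: nth_append)
  then show ?thesis by (simp add: holds_def plug_def sat_inst)
qed

section \<open>Closure properties of definable predicates\<close>

locale fo_structure =
  fixes L :: "('f, 'r) lang" and U :: "('f, 'r, 'u) struct"
  assumes struct: "is_struct L U"
begin

abbreviation T :: "nat \<Rightarrow> 'u list set" where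
  "T \<equiv> tuples (Dom U)"

text \<open>Only the values of \<open>P\<close> on \<open>T k\<close> matter.\<close>

definition definable :: "'u set \<Rightarrow> nat \<Rightarrow> ('u list \<Rightarrow> bool) \<Rightarrow> bool" where
  "definable A k P \<longleftrightarrow> (\<exists>\<phi>\<in>Forms L A {..<k}. \<forall>a\<in>T k. holds U \<phi> a = P a)"

lemma definable_holds: "\<phi> \<in> Forms L A {..<k} \<Longrightarrow> definable A k (holds U \<phi>)"
  by (auto simp: definable_def)

lemma definable_cong: "(\<And>a. a \<in> T k \<Longrightarrow> P a = Q a) \<Longrightarrow> definable A k P = definable A k Q"
  by (simp add: definable_def)

lemma definable_mono: "definable A k P \<Longrightarrow> A \<subseteq> B \<Longrightarrow> definable B k P"
  unfolding definable_def using Forms_mono by blast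

lemma definable_not: "definable A k P \<Longrightarrow> definable A k (\<lambda>a. \<not> P a)"
proof -
  assume "definable A k P"
  then obtain \<phi> where "\<phi> \<in> Forms L A {..<k}" "\<forall>a\<in>T k. holds U \<phi> a = P a"
    unfolding definable_def by blast
  then show ?thesis unfolding definable_def by (intro bexI[of _ "Neg \<phi>"]) simp_all
qed

lemma definable_conj:
  assumes "definable A k P" "definable A k Q"
  shows "definable A k (\<lambda>a. P a \<and> Q a)"
proof -
  obtain \<phi> \<psi> where "\<phi> \<in> Forms L A {..<k}" "\<forall>a\<in>T k. holds U \<phi> a = P a"
    "\<psi> \<in> Forms L A {..<k}" "\<forall>a\<in>T k. holds U \<psi> a = Q a"
    using assms unfolding definable_def by blast
  then show ?thesis unfolding definable_def by (intro bexI[of _ "Conj \<phi> \<psi>"]) (auto simp: Forms_def)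
qed

lemma definable_const: "definable A k (\<lambda>a. c)"
proof -
  have "Ex 0 (Eq (Var 0) (Var 0)) \<in> Forms L A {..<k}"
    "\<forall>a\<in>T k. holds U (Ex 0 (Eq (Var 0) (Var 0))) a = True"
    using struct by (auto simp: Forms_def holds_def is_struct_def)
  then have "definable A k (\<lambda>a. True)" unfolding definable_def by blast+
  with definable_not[OF this] show ?thesis by (cases c) simp_all
qed

lemma definable_iff_const: "definable A k P \<Longrightarrow> definable A k (\<lambda>a. P a = c)"
  by (cases c) (simp_all add: definable_not)

lemma definable_ball:
  assumes "finite I" "\<And>i. i \<in> I \<Longrightarrow> definable A k (P i)"
  shows "definable A k (\<lambda>a. \<forall>i\<in>I. P i a)"
  using assms
proof (induction I)
  case (insert x F)
  have "definable A k (\<lambda>a. P x a \<and> (\<forall>i\<in>F. P i a))"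
    using insert by (intro definable_conj[of A k "P x" "\<lambda>a. \<forall>i\<in>F. P i a"]) simp_all
  then show ?case by simp
qed (simp add: definable_const)

lemma definable_bex:
  assumes "finite I" "\<And>i. i \<in> I \<Longrightarrow> definable A k (P i)"
  shows "definable A k (\<lambda>a. \<exists>i\<in>I. P i a)"
proof -
  have "definable A k (\<lambda>a. \<not> P i a)" if "i \<in> I" for i using assms(2)[OF that] by (rule definable_not)
  then have "definable A k (\<lambda>a. \<not> (\<forall>i\<in>I. \<not> P i a))"
    using assms(1) by (intro definable_not[of A k "\<lambda>a. \<forall>i\<in>I. \<not> P i a"] definable_ball[of I A k "\<lambda>i a. \<not> P i a"])
  then show ?thesis by simp
qed

lemma definable_ex1:
  assumes "definable A (Suc k) P"
  shows "definable A k (\<lambda>a. \<exists>u\<in>Dom U. P (a @ [u]))"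
proof -
  obtain \<phi> where \<phi>: "\<phi> \<in> Forms L A {..<Suc k}" "\<And>a. a \<in> T (Suc k) \<Longrightarrow> holds U \<phi> a = P a"
    using assms by (auto simp: definable_def)
  have "holds U (Ex k \<phi>) a = (\<exists>u\<in>Dom U. P (a @ [u]))" if "a \<in> T k" for a
    using that \<phi> holds_Ex[of \<phi> k a U] by (auto simp: Forms_def tuples_def)
  with Forms_Ex[OF \<phi>(1)] show ?thesis unfolding definable_def by blast
qed

lemma definable_ex:
  assumes "definable A (k + m) P"
  shows "definable A k (\<lambda>a. \<exists>b\<in>T m. P (a @ b))"
  using assms
proof (induction m arbitrary: P)
  case 0
  then show ?case by (simp add: tuples_def)
next
  case (Suc m)
  have "definable A (k + m) (\<lambda>a. \<exists>u\<in>Dom U. P (a @ [u]))" using Suc.prems by (intro definable_ex1) simp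
  from Suc.IH[OF this] have "definable A k (\<lambda>a. \<exists>b\<in>T m. \<exists>u\<in>Dom U. P ((a @ b) @ [u]))" .
  moreover have "(\<exists>b\<in>T (Suc m). P (a @ b)) \<longleftrightarrow> (\<exists>b\<in>T m. \<exists>u\<in>Dom U. P ((a @ b) @ [u]))" for a
    by (simp add: Bex_def tuples_Suc_iff) (metis append_assoc)
  ultimately show ?case by simp
qed

text \<open>Plugging in constants, permuting coordinates and duplicating them are all instances.
  \<open>s i\<close> tells what the \<open>i\<close>-th argument of \<open>P\<close> becomes:
  \<open>Inl j\<close> is the \<open>j\<close>-th coordinate of the new tuple and
  \<open>Inr a\<close> is the constant \<open>a\<close>. The function \<open>g\<close> is kept apart
  from \<open>s\<close> so that the conclusion can carry whatever list expression an application
  needs.\<close>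

lemma definable_subst:
  fixes s :: "nat \<Rightarrow> nat + 'u"
  assumes P: "definable A k P" and AB: "A \<subseteq> B" "B \<subseteq> Dom U"
    and s: "\<And>i. i < k \<Longrightarrow> (case s i of Inl j \<Rightarrow> j < m | Inr a \<Rightarrow> a \<in> B)"
    and g: "\<And>z. z \<in> T m \<Longrightarrow> length (g z) = k"
      "\<And>z i. z \<in> T m \<Longrightarrow> i < k \<Longrightarrow> g z ! i = (case s i of Inl j \<Rightarrow> z ! j | Inr a \<Rightarrow> a)"
  shows "definable B m (\<lambda>z. P (g z))"
proof -
  obtain \<phi> where \<phi>: "wf_fm L \<phi>" "pars \<phi> \<subseteq> A" "fv \<phi> \<subseteq> {..<k}"
    and P: "\<And>a. a \<in> T k \<Longrightarrow> holds U \<phi> a = P a"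
    using P by (auto simp: definable_def Forms_def)
  define t :: "nat \<Rightarrow> ('f, 'u) tm" where
    "t i = (case s i of Inl j \<Rightarrow> Var j | Inr a \<Rightarrow> Par a)" for i
  have "\<exists>\<psi>. wf_fm L \<psi> \<and> fv \<psi> \<subseteq> (\<Union>i\<in>fv \<phi>. fv_tm (t i)) \<union> (\<Union>a\<in>pars \<phi>. fv_tm (Par a :: ('f, 'u) tm)) \<and>
    pars \<psi> \<subseteq> (\<Union>i\<in>fv \<phi>. tpars (t i)) \<union> (\<Union>a\<in>pars \<phi>. tpars (Par a :: ('f, 'u) tm)) \<and>
    (\<forall>e. (\<forall>a\<in>pars \<phi>. eval U e (Par a) = a) \<longrightarrow> sat U e \<psi> = sat U (\<lambda>i. eval U e (t i)) \<phi>)"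
    using \<phi>(1) by (intro fm_subst) (auto simp: t_def split: sum.splits)
  then obtain \<psi> where \<psi>: "wf_fm L \<psi>" "fv \<psi> \<subseteq> (\<Union>i\<in>fv \<phi>. fv_tm (t i))"
    "pars \<psi> \<subseteq> (\<Union>i\<in>fv \<phi>. tpars (t i)) \<union> pars \<phi>"
    "\<And>e. sat U e \<psi> = sat U (\<lambda>i. eval U e (t i)) \<phi>"
    by auto
  have "\<psi> \<in> Forms L B {..<m}"
    unfolding Forms_def
  proof (safe intro!: \<psi>(1))
    fix x assume "x \<in> pars \<psi>"
    with \<psi>(3) consider "x \<in> pars \<phi>" | i where "i \<in> fv \<phi>" "x \<in> tpars (t i)" by blast
    then show "x \<in> B"
    proof cases
      case 1
      then show ?thesis using \<phi>(2) AB(1) by blast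
    next
      case 2
      then have "i < k" using \<phi>(3) by blast
      from s[OF this] 2 show ?thesis by (simp add: t_def split: sum.splits)
    qed
  next
    fix x assume "x \<in> fv \<psi>"
    then obtain i where i: "i \<in> fv \<phi>" "x \<in> fv_tm (t i)" using \<psi>(2) by blast
    then have "i < k" using \<phi>(3) by blast
    from s[OF this] i show "x < m" by (simp add: t_def split: sum.splits)
  qed
  moreover have "holds U \<psi> z = P (g z)" if z: "z \<in> T m" for z
  proof -
    have gi: "g z ! i = eval U (\<lambda>i. z ! i) (t i)" if "i < k" for i
      using g(2)[OF z that] by (simp add: t_def split: sum.splits)
    have "g z ! i \<in> Dom U" if "i < k" for i
      using g(2)[OF z that] s[OF that] z AB by (auto split: sum.splits simp: nth_tuples)
    then have "g z \<in> T k" using g(1)[OF z] by (auto simp: tuples_def in_set_conv_nth)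
    moreover have "holds U \<psi> z = holds U \<phi> (g z)"
      unfolding holds_def[of U \<psi>] \<psi>(4) using \<phi>(3) by (intro sat_eq_holds[of _ k]) (simp_all add: gi)
    ultimately show ?thesis using P by simp
  qed
  ultimately show ?thesis unfolding definable_def by blast
qed

lemma definable_reindex:
  assumes "definable A k P" "A \<subseteq> Dom U"
    and "\<And>i. i < k \<Longrightarrow> f i < m"
    and "\<And>z. z \<in> T m \<Longrightarrow> length (g z) = k"
    and "\<And>z i. z \<in> T m \<Longrightarrow> i < k \<Longrightarrow> g z ! i = z ! f i"
  shows "definable A m (\<lambda>z. P (g z))"
proof -
  have 1: "\<And>i. i < k \<Longrightarrow> (case (Inl (f i) :: nat + 'u) of Inl j \<Rightarrow> j < m | Inr a \<Rightarrow> a \<in> A)"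
    using assms(3) by (simp only: sum.case)
  have 2: "\<And>z i. z \<in> T m \<Longrightarrow> i < k \<Longrightarrow> g z ! i = (case Inl (f i) of Inl j \<Rightarrow> z ! j | Inr a \<Rightarrow> a)"
    using assms(5) by (simp only: sum.case)
  show ?thesis by (rule definable_subst[OF assms(1) subset_refl assms(2) 1 assms(4) 2])
qed

lemma definable_plug:
  assumes P: "definable A (k + m) P" and AB: "A \<subseteq> B" "B \<subseteq> Dom U" and b: "b \<in> tuples B m"
  shows "definable B k (\<lambda>a. P (a @ b))"
proof -
  define s where "s i = (if i < k then Inl i else Inr (b ! (i - k)))" for i
  have 1: "case s i of Inl j \<Rightarrow> j < k | Inr a \<Rightarrow> a \<in> B" if "i < k + m" for i
    using that nth_tuples[OF b, of "i - k"] by (auto simp: s_def)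
  have 2: "length (z @ b) = k + m" if "z \<in> T k" for z
    using length_tuples[OF that] length_tuples[OF b] by simp
  have 3: "(z @ b) ! i = (case s i of Inl j \<Rightarrow> z ! j | Inr a \<Rightarrow> a)"
    if "z \<in> T k" "i < k + m" for z i
    using length_tuples[OF that(1)] by (simp add: s_def nth_append)
  show ?thesis by (rule definable_subst[OF P AB 1 2 3])
qed

lemma definable_plug_left:
  assumes P: "definable A (k + m) P" and AB: "A \<subseteq> B" "B \<subseteq> Dom U" and a: "a \<in> tuples B k"
  shows "definable B m (\<lambda>b. P (a @ b))"
proof -
  define s where "s i = (if i < k then Inr (a ! i) else Inl (i - k))" for i
  have 1: "case s i of Inl j \<Rightarrow> j < m | Inr a \<Rightarrow> a \<in> B" if "i < k + m" for i
    using that nth_tuples[OF a, of i] by (auto simp: s_def)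
  have 2: "length (a @ z) = k + m" if "z \<in> T m" for z
    using length_tuples[OF that] length_tuples[OF a] by simp
  have 3: "(a @ z) ! i = (case s i of Inl j \<Rightarrow> z ! j | Inr a \<Rightarrow> a)"
    if "z \<in> T m" "i < k + m" for z i
    using length_tuples[OF a] by (simp add: s_def nth_append)
  show ?thesis by (rule definable_subst[OF P AB 1 2 3])
qed

lemma definable_swap:
  assumes P: "definable A (k + m) P" and A: "A \<subseteq> Dom U"
  shows "definable A (m + k) (\<lambda>z. P (drop m z @ take m z))"
proof -
  define f where "f i = (if i < k then m + i else i - k)" for i
  have 1: "f i < m + k" if "i < k + m" for i
    using that by (auto simp: f_def)
  have 2: "length (drop m z @ take m z) = k + m" if "z \<in> T (m + k)" for z
    using length_tuples[OF that] by simp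
  have 3: "(drop m z @ take m z) ! i = z ! f i" if "z \<in> T (m + k)" "i < k + m" for z i
    using length_tuples[OF that(1)] that(2) by (auto simp: f_def nth_append)
  show ?thesis by (rule definable_reindex[OF P A 1 2 3])
qed

lemma definable_finite_params:
  assumes "definable A k P"
  obtains c where "set c \<subseteq> A" "definable (set c) k P"
proof -
  obtain \<phi> where \<phi>: "\<phi> \<in> Forms L A {..<k}" "\<forall>a\<in>T k. holds U \<phi> a = P a"
    using assms unfolding definable_def by (rule bexE)
  obtain c where c: "set c = pars \<phi>" using finite_list[OF finite_pars[of \<phi>]] by (rule exE)
  have "set c \<subseteq> A" using \<phi>(1) c by (simp add: Forms_def)
  moreover have "definable (set c) k P"
    unfolding definable_def
  proof (rule bexI)
    show "\<phi> \<in> Forms L (set c) {..<k}" using \<phi>(1) c by (simp add: Forms_def)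
  qed (rule \<phi>(2))
  ultimately show ?thesis by (rule that)
qed

text \<open>An entry may occur several times in \<open>c\<close>; \<open>ix\<close> picks one
  occurrence, and a parameter outside \<open>A\<close> becomes the variable at that position. Since
  \<open>c\<close> itself is put back into these positions, truth values do not change.\<close>

lemma definable_unplug:
  assumes "definable (A \<union> set c) k P"
  obtains Q where "definable A (k + length c) Q" "\<And>a. a \<in> T k \<Longrightarrow> P a = Q (a @ c)"
proof -
  obtain \<phi> where \<phi>: "wf_fm L \<phi>" "pars \<phi> \<subseteq> A \<union> set c" "fv \<phi> \<subseteq> {..<k}"
    and P: "\<And>a. a \<in> T k \<Longrightarrow> holds U \<phi> a = P a"
    using assms by (auto simp: definable_def Forms_def)
  have "\<forall>a\<in>set c. \<exists>i. i < length c \<and> c ! i = a" by (auto simp: in_set_conv_nth)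
  then obtain ix where ix: "\<And>a. a \<in> set c \<Longrightarrow> ix a < length c \<and> c ! ix a = a" by metis
  define h :: "'u \<Rightarrow> ('f, 'u) tm" where "h a = (if a \<in> A then Par a else Var (k + ix a))" for a
  have "\<exists>\<psi>. wf_fm L \<psi> \<and> fv \<psi> \<subseteq> (\<Union>i\<in>fv \<phi>. fv_tm (Var i :: ('f, 'u) tm)) \<union> (\<Union>a\<in>pars \<phi>. fv_tm (h a)) \<and>
    pars \<psi> \<subseteq> (\<Union>i\<in>fv \<phi>. tpars (Var i :: ('f, 'u) tm)) \<union> (\<Union>a\<in>pars \<phi>. tpars (h a)) \<and>
    (\<forall>e. (\<forall>a\<in>pars \<phi>. eval U e (h a) = a) \<longrightarrow> sat U e \<psi> = sat U (\<lambda>i. eval U e (Var i)) \<phi>)"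
    using \<phi>(1) by (intro fm_subst) (auto simp: h_def)
  then obtain \<psi> where \<psi>: "wf_fm L \<psi>" "fv \<psi> \<subseteq> fv \<phi> \<union> (\<Union>a\<in>pars \<phi>. fv_tm (h a))"
    "pars \<psi> \<subseteq> (\<Union>a\<in>pars \<phi>. tpars (h a))"
    "\<And>e. (\<forall>a\<in>pars \<phi>. eval U e (h a) = a) \<Longrightarrow> sat U e \<psi> = sat U e \<phi>"
    by auto
  have "\<psi> \<in> Forms L A {..<k + length c}"
    unfolding Forms_def
  proof (safe intro!: \<psi>(1))
    fix x assume "x \<in> pars \<psi>"
    then obtain a where "x \<in> tpars (h a)" using \<psi>(3) by blast
    then show "x \<in> A" by (simp add: h_def split: if_splits)
  next
    fix x assume "x \<in> fv \<psi>"
    with \<psi>(2) consider "x \<in> fv \<phi>" | a where "a \<in> pars \<phi>" "x \<in> fv_tm (h a)" by blast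
    then show "x < k + length c"
    proof cases
      case 1
      then show ?thesis using \<phi>(3) by auto
    next
      case 2
      then have "a \<in> set c" "x = k + ix a" using \<phi>(2) by (auto simp: h_def split: if_splits)
      then show ?thesis using ix by simp
    qed
  qed
  then have "definable A (k + length c) (holds U \<psi>)" by (rule definable_holds)
  moreover have "P a = holds U \<psi> (a @ c)" if a: "a \<in> T k" for a
  proof -
    have "\<forall>x\<in>pars \<phi>. eval U (\<lambda>i. (a @ c) ! i) (h x) = x"
      using \<phi>(2) ix length_tuples[OF a] by (auto simp: h_def)
    then have "holds U \<psi> (a @ c) = sat U (\<lambda>i. (a @ c) ! i) \<phi>"
      unfolding holds_def by (rule \<psi>(4))
    also have "\<dots> = holds U \<phi> a"
      using \<phi>(3) length_tuples[OF a] by (intro sat_eq_holds[of _ k]) (auto simp: nth_append)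
    finally show ?thesis using P[OF a] by simp
  qed
  ultimately show ?thesis by (rule that)
qed

text \<open>Separates a formula over \<open>A\<close> into a parameter-free formula and a finite
  tuple. The tuple can afterwards be quantified over, or be exchanged for another one of the same
  type.\<close>

lemma definable_unplug_finite:
  assumes "definable A k P"
  obtains c m Q where "c \<in> tuples A m" "definable {} (k + m) Q" "\<And>a. a \<in> T k \<Longrightarrow> P a = Q (a @ c)"
proof -
  obtain c where c: "set c \<subseteq> A" "definable (set c) k P" using definable_finite_params[OF assms] .
  from c(2) have "definable ({} \<union> set c) k P" by simp
  then obtain Q where Q: "definable {} (k + length c) Q" "\<And>a. a \<in> T k \<Longrightarrow> P a = Q (a @ c)"
    using definable_unplug by blast
  have "c \<in> tuples A (length c)" using c(1) by (simp add: tuples_def)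
  from that[OF this Q] show ?thesis .
qed

end

section \<open>Saturation and homogeneity\<close>

locale monster_model = fo_structure L U
  for L :: "('f, 'r) lang" and U :: "('f, 'r, 'u) struct" +
  fixes \<kappa> :: "'k rel"
  assumes Card_order_\<kappa>: "Card_order \<kappa>" and uncountable_\<kappa>: "natLeq <o \<kappa>"
    and saturated: "saturated L \<kappa> U" and homogeneous: "strongly_homogeneous L \<kappa> U"
begin

definition small :: "'u set \<Rightarrow> bool" where
  "small A \<longleftrightarrow> A \<subseteq> Dom U \<and> |A| <o \<kappa>"

lemma small_Dom: "small A \<Longrightarrow> A \<subseteq> Dom U"
  by (simp add: small_def)

lemma small_Un:
  assumes "small A" "small B"
  shows "small (A \<union> B)"
proof -
  have "infinite (Field \<kappa>)"
    using cinfinite_mono[OF ordLess_imp_ordLeq[OF uncountable_\<kappa>] natLeq_cinfinite]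
    by (simp add: cinfinite_def)
  then show ?thesis using assms Card_order_\<kappa>
    by (auto simp: small_def intro: card_of_Un_ordLess_infinite_Field)
qed

text \<open>Strictness of \<open>natLeq <o \<kappa>\<close> makes the parameters of a countable
  sequence small, so that saturation applies over an entire Morley sequence.\<close>

lemma small_UN_set:
  fixes a :: "nat \<Rightarrow> 'u list"
  assumes "\<And>i. set (a i) \<subseteq> Dom U"
  shows "small (\<Union>i. set (a i))"
proof -
  have "|\<Union>i. set (a i)| \<le>o |UNIV :: nat set|"
  proof (rule card_of_UNION_ordLeq_infinite)
    show "\<forall>i\<in>UNIV. |set (a i)| \<le>o |UNIV :: nat set|"
    proof
      fix i
      obtain f :: "'u \<Rightarrow> nat" where "inj_on f (set (a i))"
        using finite_imp_inj_to_nat_seg[of "set (a i)"] by blast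
      then show "|set (a i)| \<le>o |UNIV :: nat set|" by (intro card_of_ordLeqI) auto
    qed
  qed (auto intro: card_of_mono1)
  then have "|\<Union>i. set (a i)| <o \<kappa>"
    using ordLeq_ordLess_trans[OF ordLeq_ordIso_trans[OF _ card_of_nat] uncountable_\<kappa>] by blast
  then show ?thesis using assms by (auto simp: small_def)
qed

lemma small_set: "set xs \<subseteq> Dom U \<Longrightarrow> small (set xs)"
  using small_UN_set[of "\<lambda>_. xs"] by simp

lemma small_tuple: "b \<in> T k \<Longrightarrow> small (set b)"
  by (intro small_set) (simp add: tuples_def)

text \<open>Compactness. As \<open>saturated\<close> speaks of complete types only, the formulas
  defining members of \<open>\<F>\<close> are extended by Zorn's lemma to a maximal finitely
  satisfiable set of formulas over \<open>A\<close>, and such a set is complete.\<close>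

lemma realize_family:
  assumes A: "small A" and definable: "\<And>P. P \<in> \<F> \<Longrightarrow> definable A k P"
    and fs: "\<And>\<G>. \<G> \<subseteq> \<F> \<Longrightarrow> finite \<G> \<Longrightarrow> \<exists>a\<in>T k. \<forall>P\<in>\<G>. P a"
  shows "\<exists>a\<in>T k. \<forall>P\<in>\<F>. P a"
proof -
  define FS where "FS \<Gamma> \<longleftrightarrow> (\<forall>F\<subseteq>\<Gamma>. finite F \<longrightarrow> (\<exists>a\<in>T k. \<forall>\<phi>\<in>F. holds U \<phi> a))" for \<Gamma>
  define \<Sigma> where "\<Sigma> = {\<phi> \<in> Forms L A {..<k}. \<exists>P\<in>\<F>. \<forall>a\<in>T k. holds U \<phi> a = P a}"
  define \<C> where "\<C> = {\<Gamma>. \<Sigma> \<subseteq> \<Gamma> \<and> \<Gamma> \<subseteq> Forms L A {..<k} \<and> FS \<Gamma>}"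
  have "FS \<Sigma>"
    unfolding FS_def
  proof (intro allI impI)
    fix F assume F: "F \<subseteq> \<Sigma>" "finite F"
    then have "\<forall>\<phi>\<in>F. \<exists>P. P \<in> \<F> \<and> (\<forall>a\<in>T k. holds U \<phi> a = P a)" unfolding \<Sigma>_def by blast
    then obtain \<pi> where \<pi>: "\<forall>\<phi>\<in>F. \<pi> \<phi> \<in> \<F> \<and> (\<forall>a\<in>T k. holds U \<phi> a = \<pi> \<phi> a)"
      by (rule bchoice[THEN exE])
    have "\<pi> ` F \<subseteq> \<F>" using \<pi> by auto
    from fs[OF this finite_imageI[OF F(2)]] obtain a where a: "a \<in> T k" "\<forall>P\<in>\<pi> ` F. P a"
      by (rule bexE)
    have "\<forall>\<phi>\<in>F. holds U \<phi> a"
    proof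
      fix \<phi> assume "\<phi> \<in> F"
      then show "holds U \<phi> a" using \<pi>[rule_format, of \<phi>] a by auto
    qed
    with a(1) show "\<exists>a\<in>T k. \<forall>\<phi>\<in>F. holds U \<phi> a" by (rule bexI[rotated])
  qed
  then have "\<Sigma> \<in> \<C>" by (auto simp: \<C>_def \<Sigma>_def)
  have "\<Union>C \<in> \<C>" if C: "C \<noteq> {}" "subset.chain \<C> C" for C
  proof -
    have sub: "C \<subseteq> \<C>" using C(2) by (simp add: subset.chain_def)
    have "FS (\<Union>C)"
      unfolding FS_def
    proof (intro allI impI)
      fix F assume F: "F \<subseteq> \<Union>C" "finite F"
      obtain \<Gamma> where "\<Gamma> \<in> C" "F \<subseteq> \<Gamma>" using finite_subset_Union_chain[OF F(2,1) C] by blast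
      moreover have "FS \<Gamma>" using sub \<open>\<Gamma> \<in> C\<close> by (auto simp: \<C>_def)
      ultimately show "\<exists>a\<in>T k. \<forall>\<phi>\<in>F. holds U \<phi> a" using F(2) by (simp add: FS_def)
    qed
    then show ?thesis using sub C(1) by (auto simp: \<C>_def)
  qed
  then have "\<exists>\<Gamma>\<in>\<C>. \<forall>X\<in>\<C>. \<Gamma> \<subseteq> X \<longrightarrow> X = \<Gamma>"
    using \<open>\<Sigma> \<in> \<C>\<close> by (intro subset_Zorn_nonempty) auto
  then obtain \<Gamma> where \<Gamma>: "\<Gamma> \<in> \<C>" and max: "\<forall>X\<in>\<C>. \<Gamma> \<subseteq> X \<longrightarrow> X = \<Gamma>"
    by (rule bexE)
  \<comment> \<open>Maximality in refuting form: a formula left out of \<open>\<Gamma>\<close> is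
    inconsistent with finitely many members of \<open>\<Gamma>\<close>. If both
    \<open>\<phi>\<close> and \<open>Neg \<phi>\<close> were left out, the two finite sets together
    would have no realization.\<close>
  have ext: "\<exists>F\<subseteq>\<Gamma>. finite F \<and> (\<forall>a\<in>T k. (\<forall>\<psi>\<in>F. holds U \<psi> a) \<longrightarrow> \<not> holds U \<phi> a)"
    if "\<phi> \<in> Forms L A {..<k}" "\<phi> \<notin> \<Gamma>" for \<phi>
  proof -
    have "\<not> FS (insert \<phi> \<Gamma>)"
    proof
      assume "FS (insert \<phi> \<Gamma>)"
      then have "insert \<phi> \<Gamma> \<in> \<C>" using \<Gamma> that(1) by (simp add: \<C>_def subset_insertI2)
      then have "insert \<phi> \<Gamma> = \<Gamma>" using max by (simp add: subset_insertI)
      with that(2) show False by blast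
    qed
    then obtain F where F: "F \<subseteq> insert \<phi> \<Gamma>" "finite F"
      and F_unsat: "\<not> (\<exists>a\<in>T k. \<forall>\<psi>\<in>F. holds U \<psi> a)"
      unfolding FS_def not_all not_imp by (elim exE conjE) (rule that)
    have "F - {\<phi>} \<subseteq> \<Gamma> \<and> finite (F - {\<phi>})" using F by auto
    moreover have "\<forall>a\<in>T k. (\<forall>\<psi>\<in>F - {\<phi>}. holds U \<psi> a) \<longrightarrow> \<not> holds U \<phi> a"
    proof (intro ballI impI notI)
      fix a assume "a \<in> T k" "\<forall>\<psi>\<in>F - {\<phi>}. holds U \<psi> a" "holds U \<phi> a"
      then have "\<forall>\<psi>\<in>F. holds U \<psi> a" by blast
      with \<open>a \<in> T k\<close> F_unsat show False by blast
    qed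
    ultimately show ?thesis by (intro exI[of _ "F - {\<phi>}"]) simp
  qed
  have "\<phi> \<in> \<Gamma> \<or> Neg \<phi> \<in> \<Gamma>" if \<phi>: "\<phi> \<in> Forms L A {..<k}" for \<phi>
  proof (rule ccontr)
    assume "\<not> ?thesis"
    then obtain F1 F2 where
      1: "F1 \<subseteq> \<Gamma>" "finite F1" "\<forall>a\<in>T k. (\<forall>\<psi>\<in>F1. holds U \<psi> a) \<longrightarrow> \<not> holds U \<phi> a" and
      2: "F2 \<subseteq> \<Gamma>" "finite F2" "\<forall>a\<in>T k. (\<forall>\<psi>\<in>F2. holds U \<psi> a) \<longrightarrow> \<not> holds U (Neg \<phi>) a"
      using ext[OF \<phi>] ext[of "Neg \<phi>"] \<phi> by auto
    have "FS \<Gamma>" using \<Gamma> by (simp add: \<C>_def)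
    moreover have "F1 \<union> F2 \<subseteq> \<Gamma>" "finite (F1 \<union> F2)" using 1 2 by auto
    ultimately have "\<exists>a\<in>T k. \<forall>\<psi>\<in>F1 \<union> F2. holds U \<psi> a"
      by (simp only: FS_def)
    then obtain a where "a \<in> T k" "\<forall>\<psi>\<in>F1 \<union> F2. holds U \<psi> a" by (rule bexE)
    then have "\<not> holds U \<phi> a" "\<not> holds U (Neg \<phi>) a"
      using 1(3)[rule_format, of a] 2(3)[rule_format, of a] by auto
    then show False by simp
  qed
  then have "complete_type L U A k \<Gamma>" using \<Gamma> by (auto simp: complete_type_def \<C>_def FS_def)
  then obtain a where a: "realizes U k a \<Gamma>"
    using saturated A unfolding saturated_def small_def by blast
  have "P a" if P: "P \<in> \<F>" for P
  proof -
    obtain \<phi> where \<phi>: "\<phi> \<in> Forms L A {..<k}" "\<forall>a\<in>T k. holds U \<phi> a = P a"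
      using definable[OF P] unfolding definable_def by (rule bexE)
    then have "\<phi> \<in> \<Sigma>" using P by (auto simp: \<Sigma>_def)
    then have "\<phi> \<in> \<Gamma>" using \<Gamma> by (auto simp: \<C>_def)
    with a have "a \<in> T k" "holds U \<phi> a" by (simp_all add: realizes_def)
    with \<phi>(2) show ?thesis by blast
  qed
  with a show ?thesis by (auto simp: realizes_def)
qed

text \<open>The relation \<open>tp(b/A) = tp(b'/A)\<close>, phrased with predicates so that it
  applies to any definable condition without naming a formula.\<close>

definition eqtype :: "'u set \<Rightarrow> nat \<Rightarrow> 'u list \<Rightarrow> 'u list \<Rightarrow> bool" where
  "eqtype A k b b' \<longleftrightarrow> b \<in> T k \<and> b' \<in> T k \<and> (\<forall>P. definable A k P \<longrightarrow> P b = P b')"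

lemma eqtypeD: "eqtype A k b b' \<Longrightarrow> definable A k P \<Longrightarrow> P b = P b'"
  unfolding eqtype_def by blast

text \<open>The map that fixes \<open>A\<close> and sends \<open>b\<close> to \<open>b'\<close>
  coordinatewise is elementary, and homogeneity over the small set \<open>A \<union> set b\<close>
  extends it. Since \<open>b\<close> may have repeated entries or meet \<open>A\<close>, the map is
  written with a chosen index \<open>ix\<close>, and equations contained in the type show that it
  still does what is wanted.\<close>

lemma eqtype_automorphism:
  assumes A: "small A" and eq: "eqtype A k b b'"
  obtains \<sigma> where "automorphism L U \<sigma>" "\<And>a. a \<in> A \<Longrightarrow> \<sigma> a = a" "map \<sigma> b = b'"
proof -
  have AD: "A \<subseteq> Dom U" using A by (rule small_Dom)
  have b: "b \<in> T k" "b' \<in> T k" using eq by (auto simp: eqtype_def)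
  have len: "length b = k" "length b' = k" using b by (auto simp: tuples_def)
  have "\<forall>x\<in>set b. \<exists>i. i < k \<and> b ! i = x" using len by (auto simp: in_set_conv_nth)
  then obtain ix where ix: "\<And>x. x \<in> set b \<Longrightarrow> ix x < k \<and> b ! ix x = x" by metis
  define h where "h x = (if x \<in> set b then b' ! ix x else x)" for x
  define s where "s x = (if x \<in> set b then Inl (ix x) else Inr x)" for x
  \<comment> \<open>a formula evaluated at a tuple from \<open>A \<union> b\<close> is an \<open>A\<close>-definable condition on \<open>b\<close>\<close>
  have key: "holds U \<phi> z = holds U \<phi> (map h z)"
    if \<phi>: "\<phi> \<in> Forms L {} {..<j}" and z: "z \<in> tuples (A \<union> set b) j" for \<phi> j z
  proof -
    define g where "g y = map (\<lambda>x. if x \<in> set b then y ! ix x else x) z" for y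
    have 1: "case s (z ! i) of Inl l \<Rightarrow> l < k | Inr a \<Rightarrow> a \<in> A" if "i < j" for i
      using nth_tuples[OF z that] ix by (auto simp: s_def)
    have 2: "length (g y) = j" if "y \<in> T k" for y
      using length_tuples[OF z] by (simp add: g_def)
    have 3: "g y ! i = (case s (z ! i) of Inl l \<Rightarrow> y ! l | Inr a \<Rightarrow> a)" if "y \<in> T k" "i < j" for y i
      using length_tuples[OF z] that(2) by (simp add: g_def s_def)
    have "definable A k (\<lambda>y. holds U \<phi> (g y))"
      by (rule definable_subst[OF definable_holds[OF \<phi>] empty_subsetI AD 1 2 3])
    from eqtypeD[OF eq this] have "holds U \<phi> (g b) = holds U \<phi> (g b')" .
    moreover have "g b = map id z" unfolding g_def using ix by (intro map_cong) auto
    moreover have "g b' = map h z" unfolding g_def h_def by simp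
    ultimately show ?thesis by simp
  qed
  have "h ` (A \<union> set b) \<subseteq> Dom U"
    using AD ix nth_tuples[OF b(2)] by (auto simp: h_def)
  with key have "elementary_map L U (A \<union> set b) h" by (simp add: elementary_map_def)
  moreover have "small (A \<union> set b)" using A small_tuple[OF b(1)] by (rule small_Un)
  ultimately obtain \<sigma> where \<sigma>: "automorphism L U \<sigma>" "\<forall>a\<in>A \<union> set b. \<sigma> a = h a"
    using homogeneous unfolding strongly_homogeneous_def small_def by blast
  \<comment> \<open>Equality of two coordinates is itself a condition decided by the type, so the
    occurrence chosen by \<open>ix\<close> is irrelevant.\<close>
  have eq_nth: "b' ! i = b' ! l" if "i < k" "l < k" "b ! i = b ! l" for i l
  proof -
    have "definable A k (\<lambda>y. y ! i = y ! l)" unfolding definable_def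
      using that by (intro bexI[of _ "Eq (Var i) (Var l)"]) (auto simp: holds_def Forms_def)
    from eqtypeD[OF eq this] that show ?thesis by simp
  qed
  have "\<sigma> a = a" if a: "a \<in> A" for a
  proof (cases "a \<in> set b")
    case True
    have "definable A k (\<lambda>y. y ! ix a = a)" unfolding definable_def
      using ix[OF True] a by (intro bexI[of _ "Eq (Var (ix a)) (Par a)"]) (auto simp: holds_def Forms_def)
    from eqtypeD[OF eq this] have "b' ! ix a = a" using ix[OF True] by simp
    with True \<sigma>(2) show ?thesis by (simp add: h_def)
  next
    case False
    with a \<sigma>(2) show ?thesis by (simp add: h_def)
  qed
  moreover have "map \<sigma> b = b'"
  proof (rule nth_equalityI)
    fix i assume "i < length (map \<sigma> b)"
    then have i: "i < k" "b ! i \<in> set b" using len by auto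
    then have "\<sigma> (b ! i) = b' ! ix (b ! i)" using \<sigma>(2) by (simp add: h_def)
    also have "\<dots> = b' ! i" using ix[OF i(2)] i(1) by (intro eq_nth) auto
    finally show "map \<sigma> b ! i = b' ! i" using i len by simp
  qed (simp add: len)
  ultimately show ?thesis using that \<sigma>(1) by blast
qed

end

section \<open>Global types and Morley sequences\<close>

lemma take_drop_concat:
  assumes "\<And>x. x \<in> set xs \<Longrightarrow> length x = n" "j < length xs"
  shows "take n (drop (j * n) (concat xs)) = xs ! j"
  using assms
proof (induction xs arbitrary: j)
  case (Cons x xs)
  have x: "length x = n" using Cons.prems(1) by simp
  show ?case
  proof (cases j)
    case 0
    then show ?thesis using x by simp
  next
    case (Suc i)
    then have "take n (drop (i * n) (concat xs)) = xs ! i" using Cons by simp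
    then show ?thesis using Suc x by simp
  qed
qed simp

lemma concat_tuples: "set xs \<subseteq> tuples A n \<Longrightarrow> concat xs \<in> tuples A (length xs * n)"
  by (induction xs) (auto simp: tuples_def)

context fo_structure
begin

text \<open>A tuple of length \<open>N * n\<close> is read as \<open>N\<close> consecutive blocks of
  length \<open>n\<close>. That a single \<open>y\<close> gives \<open>F\<close> the truth value
  \<open>E j\<close> at the \<open>j\<close>-th block, for every \<open>j < N\<close>, is then one
  condition on the concatenation, and equality of types applies to it.\<close>

lemma definable_pattern:
  assumes A: "A \<subseteq> Dom U" and F: "definable A (n + k) F" and \<chi>: "definable A k \<chi>"
  shows "definable A (N * n) (\<lambda>z. \<exists>y\<in>T k. \<chi> y \<and> (\<forall>j<N. F (take n (drop (j * n) z) @ y) = E j))"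
proof -
  have block: "j * n + n \<le> N * n" if "j < N" for j
    using mult_le_mono1[of "Suc j" N n] that by simp
  have "definable A (N * n + k) (\<lambda>w. F (take n (drop (j * n) w) @ drop (N * n) w))" if "j < N" for j
  proof -
    define f where "f i = (if i < n then j * n + i else N * n + (i - n))" for i
    have 1: "f i < N * n + k" if "i < n + k" for i
      using block[OF \<open>j < N\<close>] that by (auto simp: f_def)
    have 2: "length (take n (drop (j * n) w) @ drop (N * n) w) = n + k" if "w \<in> T (N * n + k)" for w
      using length_tuples[OF that] block[OF \<open>j < N\<close>] by simp
    have 3: "(take n (drop (j * n) w) @ drop (N * n) w) ! i = w ! f i"
      if "w \<in> T (N * n + k)" "i < n + k" for w i
      using length_tuples[OF that(1)] block[OF \<open>j < N\<close>] by (simp add: f_def nth_append)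
    show ?thesis by (rule definable_reindex[OF F A 1 2 3])
  qed
  then have "definable A (N * n + k)
      (\<lambda>w. \<forall>j\<in>{..<N}. F (take n (drop (j * n) w) @ drop (N * n) w) = E j)"
    by (intro definable_ball definable_iff_const) simp_all
  moreover have "definable A (N * n + k) (\<lambda>w. \<chi> (drop (N * n) w))"
  proof -
    have 1: "N * n + i < N * n + k" if "i < k" for i using that by simp
    have 2: "length (drop (N * n) w) = k" if "w \<in> T (N * n + k)" for w
      using length_tuples[OF that] by simp
    have 3: "drop (N * n) w ! i = w ! (N * n + i)" if "w \<in> T (N * n + k)" "i < k" for w i
      using length_tuples[OF that(1)] by simp
    show ?thesis by (rule definable_reindex[OF \<chi> A 1 2 3])
  qed
  ultimately have "definable A (N * n + k) (\<lambda>w. \<chi> (drop (N * n) w) \<and>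
      (\<forall>j\<in>{..<N}. F (take n (drop (j * n) w) @ drop (N * n) w) = E j))"
    by (rule definable_conj[rotated])
  from definable_ex[OF this] have "definable A (N * n) (\<lambda>z. \<exists>y\<in>T k. \<chi> (drop (N * n) (z @ y)) \<and>
      (\<forall>j\<in>{..<N}. F (take n (drop (j * n) (z @ y)) @ drop (N * n) (z @ y)) = E j))" .
  moreover have "(\<exists>y\<in>T k. \<chi> (drop (N * n) (z @ y)) \<and>
      (\<forall>j\<in>{..<N}. F (take n (drop (j * n) (z @ y)) @ drop (N * n) (z @ y)) = E j)) \<longleftrightarrow>
    (\<exists>y\<in>T k. \<chi> y \<and> (\<forall>j<N. F (take n (drop (j * n) z) @ y) = E j))" if "z \<in> T (N * n)" for z
  proof -
    have z: "length z = N * n" using that by (rule length_tuples)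
    have "take n (drop (j * n) (z @ y)) = take n (drop (j * n) z)" if "j < N" for j y
      using block[OF that] z by (simp add: add.commute)
    then have "(\<forall>j\<in>{..<N}. F (take n (drop (j * n) (z @ y)) @ y) = E j) \<longleftrightarrow>
        (\<forall>j<N. F (take n (drop (j * n) z) @ y) = E j)" for y
      by (auto simp del: drop_append take_append)
    moreover have "drop (N * n) (z @ y) = y" for y using z by simp
    ultimately show ?thesis by (simp only:)
  qed
  ultimately show ?thesis by (rule definable_cong[THEN iffD1, rotated])
qed

lemma pattern_concat:
  assumes "set xs \<subseteq> T n" "length xs = N"
  shows "(\<forall>j<N. F (take n (drop (j * n) (concat xs)) @ y) = E j) \<longleftrightarrow> (\<forall>j<N. F (xs ! j @ y) = E j)"
proof -
  have "take n (drop (j * n) (concat xs)) = xs ! j" if "j < N" for j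
    using assms that by (intro take_drop_concat) (auto simp: tuples_def)
  then show ?thesis by simp
qed

end

context monster_model
begin

text \<open>Because \<open>y\<close> is bound in the definable condition, it need not be kept: other
  blocks of the same type come with their own \<open>y'\<close>. The predicate \<open>\<chi>\<close>
  carries along whatever is to be remembered about \<open>y\<close>.\<close>

lemma pattern_transfer:
  assumes "A \<subseteq> Dom U" "definable A (n + k) F" "definable A k \<chi>"
    and eq: "eqtype A (N * n) (concat xs) (concat ys)"
    and xs: "set xs \<subseteq> T n" "length xs = N" and ys: "set ys \<subseteq> T n" "length ys = N"
    and y: "y \<in> T k" "\<chi> y" "\<forall>j<N. F (xs ! j @ y) = E j"
  shows "\<exists>y'\<in>T k. \<chi> y' \<and> (\<forall>j<N. F (ys ! j @ y') = E j)"
proof -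
  have "\<exists>y\<in>T k. \<chi> y \<and> (\<forall>j<N. F (xs ! j @ y) = E j)" using y by blast
  moreover have "(\<exists>y\<in>T k. \<chi> y \<and> (\<forall>j<N. F (xs ! j @ y) = E j)) =
      (\<exists>y\<in>T k. \<chi> y \<and> (\<forall>j<N. F (ys ! j @ y) = E j))"
    using eqtypeD[OF eq definable_pattern[OF assms(1-3), of N E]]
    unfolding pattern_concat[OF xs] pattern_concat[OF ys] .
  ultimately show ?thesis by (simp only:)
qed

end

section \<open>Global types as families of definable predicates, and their realizations\<close>

locale global_type_model = monster_model L U \<kappa>
  for L :: "('f, 'r) lang" and U :: "('f, 'r, 'u) struct" and \<kappa> :: "'k rel" +
  fixes n :: nat and p :: "('f, 'r, 'u) fm set"
  assumes global: "global_type L U n p"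
begin

text \<open>The type is regarded as an ultrafilter on definable predicates, which removes the
  dependence on the formula chosen to define \<open>P\<close>.\<close>

definition in_type :: "('u list \<Rightarrow> bool) \<Rightarrow> bool" where
  "in_type P \<longleftrightarrow> (\<exists>\<phi>\<in>p. \<forall>a\<in>T n. holds U \<phi> a = P a)"

lemma p_Forms: "\<phi> \<in> p \<Longrightarrow> \<phi> \<in> Forms L (Dom U) {..<n}"
  using global unfolding complete_type_def by blast

lemma in_type_cong: "(\<And>a. a \<in> T n \<Longrightarrow> P a = Q a) \<Longrightarrow> in_type P = in_type Q"
  by (simp add: in_type_def)

lemma in_type_sat:
  assumes "finite \<G>" "\<And>P. P \<in> \<G> \<Longrightarrow> in_type P"
  shows "\<exists>a\<in>T n. \<forall>P\<in>\<G>. P a"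
proof -
  have "\<forall>P\<in>\<G>. \<exists>\<phi>. \<phi> \<in> p \<and> (\<forall>a\<in>T n. holds U \<phi> a = P a)"
    using assms(2) unfolding in_type_def by blast
  then obtain \<pi> where \<pi>: "\<forall>P\<in>\<G>. \<pi> P \<in> p \<and> (\<forall>a\<in>T n. holds U (\<pi> P) a = P a)"
    by (rule bchoice[THEN exE])
  then have "\<pi> ` \<G> \<subseteq> p" "finite (\<pi> ` \<G>)" using assms(1) by auto
  then have "\<exists>a\<in>T n. \<forall>\<phi>\<in>\<pi> ` \<G>. holds U \<phi> a"
    using global unfolding complete_type_def by blast
  then obtain a where a: "a \<in> T n" "\<forall>\<phi>\<in>\<pi> ` \<G>. holds U \<phi> a" by (rule bexE)
  have "\<forall>P\<in>\<G>. P a"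
  proof
    fix P assume "P \<in> \<G>"
    then show "P a" using \<pi>[rule_format, of P] a by auto
  qed
  with a(1) show ?thesis by (rule bexI[rotated])
qed

lemma in_type_sat2: "in_type P \<Longrightarrow> in_type Q \<Longrightarrow> \<exists>a\<in>T n. P a \<and> Q a"
  using in_type_sat[of "{P, Q}"] by auto

lemma in_type_sat3: "in_type P \<Longrightarrow> in_type Q \<Longrightarrow> in_type R \<Longrightarrow> \<exists>a\<in>T n. P a \<and> Q a \<and> R a"
  using in_type_sat[of "{P, Q, R}"] by auto

lemma in_type_not:
  assumes "definable (Dom U) n P"
  shows "in_type (\<lambda>a. \<not> P a) \<longleftrightarrow> \<not> in_type P"
proof -
  obtain \<phi> where \<phi>: "\<phi> \<in> Forms L (Dom U) {..<n}" "\<forall>a\<in>T n. holds U \<phi> a = P a"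
    using assms unfolding definable_def by (rule bexE)
  have "\<phi> \<in> p \<or> Neg \<phi> \<in> p" using global \<phi>(1) unfolding complete_type_def by blast
  then have "in_type P \<or> in_type (\<lambda>a. \<not> P a)"
  proof
    assume "\<phi> \<in> p"
    then show ?thesis using \<phi>(2) unfolding in_type_def by blast
  next
    assume *: "Neg \<phi> \<in> p"
    have "\<forall>a\<in>T n. holds U (Neg \<phi>) a = (\<not> P a)" using \<phi>(2) by simp
    with * have "in_type (\<lambda>a. \<not> P a)" unfolding in_type_def by (rule bexI[rotated])
    then show ?thesis ..
  qed
  with in_type_sat2[of P "\<lambda>a. \<not> P a"] show ?thesis by blast
qed

lemma in_type_conj:
  assumes "definable (Dom U) n P" "definable (Dom U) n Q" "in_type P" "in_type Q"
  shows "in_type (\<lambda>a. P a \<and> Q a)"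
proof (rule ccontr)
  assume "\<not> ?thesis"
  then have "in_type (\<lambda>a. \<not> (P a \<and> Q a))" using in_type_not[OF definable_conj[OF assms(1,2)]] by simp
  from in_type_sat3[OF assms(3,4) this] show False by blast
qed

text \<open>A complete, finitely satisfiable set is closed under equivalence: were
  \<open>\<phi>\<close> equivalent to a member of \<open>p\<close> but outside \<open>p\<close>,
  then \<open>Neg \<phi>\<close> and that member would need a common realization.\<close>

lemma mem_iff_in_type:
  assumes "\<phi> \<in> Forms L (Dom U) {..<n}"
  shows "\<phi> \<in> p \<longleftrightarrow> in_type (holds U \<phi>)"
proof
  assume "\<phi> \<in> p"
  then show "in_type (holds U \<phi>)" unfolding in_type_def by (rule bexI[rotated]) simp
next
  assume in_type: "in_type (holds U \<phi>)"
  have "Neg \<phi> \<notin> p"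
  proof
    assume "Neg \<phi> \<in> p"
    moreover have "\<forall>a\<in>T n. holds U (Neg \<phi>) a = (\<not> holds U \<phi> a)" by simp
    ultimately have "in_type (\<lambda>a. \<not> holds U \<phi> a)" unfolding in_type_def by (rule bexI[rotated])
    from in_type_sat2[OF in_type this] show False by blast
  qed
  with assms global show "\<phi> \<in> p" unfolding complete_type_def by blast
qed

text \<open>\<open>a \<Turnstile> p|B\<close>\<close>

definition realizes_over :: "'u list \<Rightarrow> 'u set \<Rightarrow> bool" where
  "realizes_over a B \<longleftrightarrow> a \<in> T n \<and> (\<forall>P. definable B n P \<longrightarrow> in_type P \<longrightarrow> P a)"

lemma realizes_over_tuple: "realizes_over a B \<Longrightarrow> a \<in> T n"
  by (simp add: realizes_over_def)

text \<open>Completeness makes realization two-sided: if \<open>P\<close> is not in the type, its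
  negation is, and this negation is again over \<open>B\<close>.\<close>

lemma realizes_overD:
  assumes "realizes_over a B" "definable B n P" "B \<subseteq> Dom U"
  shows "P a \<longleftrightarrow> in_type P"
proof -
  have "in_type P \<Longrightarrow> P a" using assms unfolding realizes_over_def by blast
  moreover have "in_type (\<lambda>a. \<not> P a) \<Longrightarrow> \<not> P a"
    using assms(1) definable_not[OF assms(2)] unfolding realizes_over_def by blast
  ultimately show ?thesis using in_type_not[OF definable_mono[OF assms(2,3)]] by blast
qed

lemma realizes_over_mono:
  assumes "realizes_over a B" "C \<subseteq> B"
  shows "realizes_over a C"
  unfolding realizes_over_def
proof (intro conjI allI impI realizes_over_tuple[OF assms(1)])
  fix P assume "definable C n P" "in_type P"
  with definable_mono[OF \<open>definable C n P\<close> assms(2)] assms(1) show "P a" unfolding realizes_over_def by blast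
qed

lemma realizes_iff_realizes_over: "B \<subseteq> Dom U \<Longrightarrow> realizes U n a (restr p B) \<longleftrightarrow> realizes_over a B"
proof (intro iffI)
  assume B: "B \<subseteq> Dom U" and a: "realizes U n a (restr p B)"
  have "P a" if P: "definable B n P" "in_type P" for P
  proof -
    obtain \<phi> where \<phi>: "\<phi> \<in> Forms L B {..<n}" "\<forall>a\<in>T n. holds U \<phi> a = P a"
      using P(1) unfolding definable_def by (rule bexE)
    have "in_type (holds U \<phi>)" using P(2) in_type_cong[of "holds U \<phi>" P] \<phi>(2) by simp
    then have "\<phi> \<in> restr p B"
      using \<phi>(1) mem_iff_in_type[OF Forms_mono[OF \<phi>(1) B]] by (simp add: restr_def Forms_def)
    with a have "a \<in> T n" "holds U \<phi> a" by (simp_all add: realizes_def)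
    with \<phi>(2) show ?thesis by blast
  qed
  with a show "realizes_over a B" unfolding realizes_over_def realizes_def by blast
next
  assume B: "B \<subseteq> Dom U" and a: "realizes_over a B"
  have "holds U \<phi> a" if "\<phi> \<in> restr p B" for \<phi>
  proof -
    have \<phi>: "\<phi> \<in> p" "pars \<phi> \<subseteq> B" using that by (auto simp: restr_def)
    note F = p_Forms[OF \<phi>(1)]
    have "in_type (holds U \<phi>)" using \<phi>(1) mem_iff_in_type[OF F] by simp
    moreover have "\<phi> \<in> Forms L B {..<n}" using F \<phi>(2) by (simp add: Forms_def)
    ultimately show ?thesis using realizes_overD[OF a _ B] definable_holds by blast
  qed
  then show "realizes U n a (restr p B)" using realizes_over_tuple[OF a] by (simp add: realizes_def)
qed

lemma ex_realizes_over:
  assumes "small B"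
  shows "\<exists>a. realizes_over a B"
proof -
  have "\<exists>a\<in>T n. \<forall>P\<in>{P. definable B n P \<and> in_type P}. P a"
  proof (rule realize_family[OF assms])
    fix \<G> assume "\<G> \<subseteq> {P. definable B n P \<and> in_type P}" "finite \<G>"
    then show "\<exists>a\<in>T n. \<forall>P\<in>\<G>. P a" by (intro in_type_sat) auto
  qed simp
  then show ?thesis unfolding realizes_over_def by blast
qed

text \<open>Finite Morley sequences are listed in reverse: the head realizes \<open>p\<close> over the tail.\<close>

primrec morley_list :: "'u set \<Rightarrow> 'u list list \<Rightarrow> bool" where
  "morley_list B [] = True"
| "morley_list B (a # xs) = (realizes_over a (B \<union> \<Union> (set ` set xs)) \<and> morley_list B xs)"

lemma morley_list_tuples: "morley_list B xs \<Longrightarrow> set xs \<subseteq> T n"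
  by (induction xs) (auto dest: realizes_over_tuple)

lemma small_tuples: "set xs \<subseteq> T n \<Longrightarrow> small (\<Union> (set ` set xs))"
  using small_set[of "concat xs"] by (force simp: tuples_def)

lemma morley_list_mono: "morley_list B xs \<Longrightarrow> C \<subseteq> B \<Longrightarrow> morley_list C xs"
  by (induction xs) (auto elim: realizes_over_mono)

lemma ex_morley_list:
  assumes "small B"
  shows "\<exists>xs. morley_list B xs \<and> length xs = N"
proof (induction N)
  case (Suc N)
  then obtain xs where xs: "morley_list B xs" "length xs = N" by blast
  obtain a where "realizes_over a (B \<union> \<Union> (set ` set xs))"
    using ex_realizes_over[OF small_Un[OF assms small_tuples[OF morley_list_tuples[OF xs(1)]]]] by blast
  with xs show ?case by (intro exI[of _ "a # xs"]) simp
qed simp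

end

section \<open>Invariant types, uniqueness of the types of finite Morley sequences, and elementarity
  of \<open>M\<close>\<close>

locale invariant_type_model = global_type_model L U \<kappa> n p
  for L :: "('f, 'r) lang" and U :: "('f, 'r, 'u) struct" and \<kappa> :: "'k rel"
    and n :: nat and p :: "('f, 'r, 'u) fm set" +
  fixes M :: "('f, 'r, 'u) struct"
  assumes elem: "elem_sub L M U" and small_M: "|Dom M| <o \<kappa>"
    and invariant: "invariant_type L U (Dom M) n p"
begin

lemma M_sub: "Dom M \<subseteq> Dom U"
  using elem by (simp add: elem_sub_def)

lemma small_Dom_M: "small (Dom M)"
  using small_M M_sub by (simp add: small_def)

text \<open>An automorphism over \<open>A\<close> taking \<open>b\<close> to \<open>b'\<close> fixes
  the parameters of a formula for \<open>Q\<close>, so it takes the instance at \<open>b\<close> to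
  an instance at \<open>b'\<close>; as it also fixes \<open>M\<close>, it preserves
  \<open>p\<close>.\<close>

lemma in_type_invariant:
  assumes A: "small A" "Dom M \<subseteq> A" and eq: "eqtype A k b b'" and Q: "definable A (n + k) Q"
  shows "in_type (\<lambda>x. Q (x @ b)) \<longleftrightarrow> in_type (\<lambda>x. Q (x @ b'))"
proof -
  obtain \<sigma> where \<sigma>: "automorphism L U \<sigma>" "\<And>a. a \<in> A \<Longrightarrow> \<sigma> a = a" "map \<sigma> b = b'"
    by (rule eqtype_automorphism[OF A(1) eq]) (rule that; simp)
  have \<sigma>U: "\<sigma> ` Dom U = Dom U" using \<sigma>(1) by (simp add: automorphism_def bij_betw_def)
  have AU: "A \<subseteq> Dom U" using A(1) by (rule small_Dom)
  have b: "b \<in> T k" "b' \<in> T k" using eq by (simp_all add: eqtype_def)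
  obtain \<phi> where \<phi>: "\<phi> \<in> Forms L A {..<n + k}" and Q: "\<forall>a\<in>T (n + k). holds U \<phi> a = Q a"
    using Q unfolding definable_def by (rule bexE)
  define \<psi> where "\<psi> = plug n b \<phi>"
  have \<psi>: "\<psi> \<in> Forms L (Dom U) {..<n}"
    using plug_Forms[OF \<phi> b(1)] AU by (simp add: \<psi>_def sup.absorb2)
  have \<psi>_holds: "holds U \<psi> a = Q (a @ b)" if "a \<in> T n" for a
  proof -
    have "holds U \<psi> a = holds U \<phi> (a @ b)"
      unfolding \<psi>_def using \<phi> length_tuples[OF that] length_tuples[OF b(1)]
      by (intro holds_plug[where k = k]) (simp_all add: Forms_def)
    with Q tuples_append[OF that b(1)] show ?thesis by simp
  qed
  have \<sigma>\<psi>: "map_fm id id \<sigma> \<psi> \<in> Forms L (Dom U) {..<n}"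
    using \<psi> \<sigma>U by (auto simp: Forms_def wf_map fv_map fm.set_map)
  have "map_fm id id \<sigma> \<phi> = map_fm id id id \<phi>"
    using \<phi> \<sigma>(2) by (intro fm.map_cong) (auto simp: Forms_def)
  then have \<sigma>\<phi>: "map_fm id id \<sigma> \<phi> = \<phi>" by (simp add: fm.map_id)
  have sat_\<sigma>: "holds U (map_fm id id \<sigma> \<theta>) (map \<sigma> a) = holds U \<theta> a"
    if "\<theta> \<in> Forms L (Dom U) {..<m}" "a \<in> T m" for \<theta> a m
  proof -
    have "holds U \<theta> a = sat U (\<lambda>i. \<sigma> (a ! i)) (map_fm id id \<sigma> \<theta>)"
      unfolding holds_def using that
      by (intro sat_automorphism[symmetric, OF struct \<sigma>(1)]) (auto simp: Forms_def nth_tuples)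
    also have "\<dots> = holds U (map_fm id id \<sigma> \<theta>) (map \<sigma> a)"
      using that by (intro sat_eq_holds[of _ m]) (auto simp: Forms_def fv_map length_tuples)
    finally show ?thesis ..
  qed
  \<comment> \<open>The moved formula is not identified syntactically with the instance at
    \<open>b'\<close>; it suffices that it defines the same predicate. The tuple \<open>a\<close> is
    pulled back along \<open>\<sigma>\<close> because satisfaction of moved formulas is known at
    images under \<open>\<sigma>\<close>.\<close>
  have \<sigma>\<psi>_holds: "holds U (map_fm id id \<sigma> \<psi>) a = Q (a @ b')" if a: "a \<in> T n" for a
  proof -
    have "\<exists>y. y \<in> Dom U \<and> \<sigma> y = x" if "x \<in> set a" for x
    proof -
      have "x \<in> \<sigma> ` Dom U" using a that \<sigma>U by (auto simp: tuples_def)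
      then show ?thesis by blast
    qed
    then obtain \<tau> where \<tau>: "\<And>x. x \<in> set a \<Longrightarrow> \<tau> x \<in> Dom U \<and> \<sigma> (\<tau> x) = x" by metis
    define a0 where "a0 = map \<tau> a"
    have a0: "a0 \<in> T n" using a \<tau> by (auto simp: a0_def tuples_def)
    have "map \<sigma> a0 = map id a" unfolding a0_def map_map using \<tau> by (intro map_cong) auto
    then have a_eq: "map \<sigma> a0 = a" by simp
    have "holds U (map_fm id id \<sigma> \<psi>) (map \<sigma> a0) = holds U \<psi> a0" by (rule sat_\<sigma>[OF \<psi> a0])
    also have "\<dots> = Q (a0 @ b)" by (rule \<psi>_holds[OF a0])
    also have "\<dots> = holds U \<phi> (a0 @ b)" using Q tuples_append[OF a0 b(1)] by simp
    also have "\<dots> = holds U (map_fm id id \<sigma> \<phi>) (map \<sigma> (a0 @ b))"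
      by (rule sat_\<sigma>[symmetric, OF Forms_mono[OF \<phi> AU] tuples_append[OF a0 b(1)]])
    also have "\<dots> = holds U \<phi> (a @ b')" using \<sigma>\<phi> a_eq \<sigma>(3) by simp
    also have "\<dots> = Q (a @ b')" using Q tuples_append[OF a b(2)] by simp
    finally show ?thesis using a_eq by simp
  qed
  have "\<forall>a\<in>Dom M. \<sigma> a = a" using \<sigma>(2) A(2) by blast
  then have "\<psi> \<in> p \<longleftrightarrow> map_fm id id \<sigma> \<psi> \<in> p"
    using invariant \<sigma>(1) \<psi> unfolding invariant_type_def by blast
  then have "in_type (holds U \<psi>) = in_type (holds U (map_fm id id \<sigma> \<psi>))"
    using mem_iff_in_type \<psi> \<sigma>\<psi> by simp
  moreover have "in_type (holds U \<psi>) = in_type (\<lambda>x. Q (x @ b))" by (rule in_type_cong) (rule \<psi>_holds)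
  moreover have "in_type (holds U (map_fm id id \<sigma> \<psi>)) = in_type (\<lambda>x. Q (x @ b'))"
    by (rule in_type_cong) (rule \<sigma>\<psi>_holds)
  ultimately show ?thesis by simp
qed

text \<open>Truth of \<open>P\<close> at head and tail amounts to membership of
  \<open>P(x, tail)\<close> in \<open>p\<close>. Invariance makes this depend only on the type of
  the tail over \<open>B\<close>, which agrees for both lists by induction. Hence finite powers of
  \<open>p\<close> are well defined over \<open>B\<close>.\<close>

lemma morley_list_eqtype:
  assumes B: "small B" "Dom M \<subseteq> B" and len: "length xs = length ys" and "morley_list B xs" "morley_list B ys"
  shows "eqtype B (length xs * n) (concat xs) (concat ys)"
  using len assms(4,5)
proof (induction xs ys rule: list_induct2)
  case Nil
  then show ?case by (simp add: eqtype_def tuples_def)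
next
  case (Cons a xs a' ys)
  let ?m = "length xs * n"
  have IH: "eqtype B ?m (concat xs) (concat ys)" using Cons by simp
  have T: "concat xs \<in> T ?m" "concat ys \<in> T ?m" using IH by (simp_all add: eqtype_def)
  have a: "realizes_over a (B \<union> \<Union> (set ` set xs))" "realizes_over a' (B \<union> \<Union> (set ` set ys))"
    using Cons.prems by simp_all
  have BU: "B \<union> \<Union> (set ` set zs) \<subseteq> Dom U" if "morley_list B zs" for zs
    using small_Dom[OF small_Un[OF B(1) small_tuples[OF morley_list_tuples[OF that]]]] .
  have sub: "concat zs \<in> tuples (B \<union> \<Union> (set ` set zs)) ?m" if "concat zs \<in> T ?m" for zs
    using that by (auto simp: tuples_def)
  have "P (a @ concat xs) = P (a' @ concat ys)" if P: "definable B (n + ?m) P" for P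
  proof -
    have "P (a @ concat xs) = in_type (\<lambda>x. P (x @ concat xs))"
      using realizes_overD[OF a(1) definable_plug[OF P _ BU sub[OF T(1)]] BU] Cons.prems by simp
    also have "\<dots> = in_type (\<lambda>x. P (x @ concat ys))" by (rule in_type_invariant[OF B IH P])
    also have "\<dots> = P (a' @ concat ys)"
      using realizes_overD[OF a(2) definable_plug[OF P _ BU sub[OF T(2)]] BU] Cons.prems by simp
    finally show ?thesis .
  qed
  moreover have "a @ concat xs \<in> T (n + ?m)" "a' @ concat ys \<in> T (n + ?m)"
    using a T by (auto intro!: tuples_append dest: realizes_over_tuple)
  ultimately have "eqtype B (n + ?m) (a @ concat xs) (a' @ concat ys)"
    unfolding eqtype_def by blast
  then show ?case by simp
qed

text \<open>Coordinates are found one at a time. Since \<open>elem_sub\<close> compares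
  \<open>M\<close> and \<open>U\<close> on parameter-free formulas, the parameters of
  \<open>P\<close> in \<open>M\<close> are first turned into coordinates.\<close>

lemma tarski_vaught:
  assumes "definable (Dom M) k P" "b \<in> T k" "P b"
  shows "\<exists>m\<in>tuples (Dom M) k. P m"
  using assms
proof (induction k arbitrary: P b)
  case 0
  then show ?case by (auto simp: tuples_def)
next
  case (Suc k)
  have "definable (Dom M) k (\<lambda>z. \<exists>u\<in>Dom U. P (z @ [u]))" by (rule definable_ex1[OF Suc.prems(1)])
  moreover obtain b0 u0 where "b0 \<in> T k" "u0 \<in> Dom U" "b = b0 @ [u0]"
    using Suc.prems(2) unfolding tuples_Suc_iff by blast
  ultimately obtain m where m: "m \<in> tuples (Dom M) k" "\<exists>u\<in>Dom U. P (m @ [u])"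
    using Suc.IH[of "\<lambda>z. \<exists>u\<in>Dom U. P (z @ [u])" b0] Suc.prems(3) by blast
  have mT: "m \<in> T k" using m(1) M_sub by (rule tuples_mono[rotated])
  obtain c l Q where c: "c \<in> tuples (Dom M) l" and Q: "definable {} (Suc k + l) Q"
    and PQ: "\<And>a. a \<in> T (Suc k) \<Longrightarrow> P a = Q (a @ c)"
    by (rule definable_unplug_finite[OF Suc.prems(1)]) (rule that; simp)
  have cT: "c \<in> T l" using c M_sub by (rule tuples_mono[rotated])
  \<comment> \<open>The parameter coordinates move to the front, so that the coordinate sought is
    the last variable and can be bound by \<open>Ex (l + k)\<close>.\<close>
  have "definable {} (l + Suc k) (\<lambda>z. Q (drop l z @ take l z))"
    by (rule definable_swap[OF Q]) simp
  then have "definable {} (Suc (l + k)) (\<lambda>z. Q (drop l z @ take l z))" by simp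
  then obtain \<phi> where \<phi>: "\<phi> \<in> Forms L {} {..<Suc (l + k)}"
    and \<phi>_holds: "\<forall>a\<in>T (Suc (l + k)). holds U \<phi> a = Q (drop l a @ take l a)"
    unfolding definable_def by (rule bexE)
  have *: "holds U \<phi> ((c @ m) @ [u]) = P (m @ [u])" if "u \<in> Dom U" for u
  proof -
    have "(c @ m) @ [u] \<in> T (Suc (l + k))"
      using cT mT that by (auto simp: tuples_def)
    moreover have "m @ [u] \<in> T (Suc k)" using mT that by (auto simp: tuples_def)
    ultimately show ?thesis using \<phi>_holds PQ length_tuples[OF c] by simp
  qed
  have cm: "c @ m \<in> tuples (Dom M) (l + k)" using c m(1) by (rule tuples_append)
  have agree: "holds M \<theta> z = holds U \<theta> z" if "\<theta> \<in> Forms L {} {..<j}" "z \<in> tuples (Dom M) j" for \<theta> j z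
    using elem that unfolding elem_sub_def by blast
  have Ex_holds: "holds S (Ex (l + k) \<phi>) (c @ m) \<longleftrightarrow> (\<exists>u\<in>Dom S. holds S \<phi> ((c @ m) @ [u]))"
    for S :: "('f, 'r, 'u) struct"
    using \<phi> length_tuples[OF cm] by (intro holds_Ex) (simp_all add: Forms_def)
  have "holds U (Ex (l + k) \<phi>) (c @ m)" using m(2) * Ex_holds[of U] by blast
  then have "holds M (Ex (l + k) \<phi>) (c @ m)" using agree[OF Forms_Ex[OF \<phi>] cm] by simp
  then obtain u where u: "u \<in> Dom M" "holds M \<phi> ((c @ m) @ [u])" using Ex_holds[of M] by blast
  have "(c @ m) @ [u] \<in> tuples (Dom M) (Suc (l + k))" using cm u(1) by (auto simp: tuples_def)
  then have "holds U \<phi> ((c @ m) @ [u])" using u(2) agree[OF \<phi>] by blast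
  then have "P (m @ [u])" using * u(1) M_sub by blast
  moreover have "m @ [u] \<in> tuples (Dom M) (Suc k)" using m(1) u(1) by (auto simp: tuples_def)
  ultimately show ?case by blast
qed

end

section \<open>Total indiscernibility and eventual NIP\<close>

lemma (in monster_model) eqtype_trans: "eqtype A k a b \<Longrightarrow> eqtype A k b c \<Longrightarrow> eqtype A k a c"
  unfolding eqtype_def by blast

section \<open>Infinite Morley sequences and limits\<close>

context global_type_model
begin

lemma morley_list_realizes_over: "morley_list B xs \<Longrightarrow> x \<in> set xs \<Longrightarrow> realizes_over x B"
  by (induction xs) (auto intro: realizes_over_mono[OF _ Un_upper1])

definition morley :: "'u set \<Rightarrow> (nat \<Rightarrow> 'u list) \<Rightarrow> bool" where
  "morley B a \<longleftrightarrow> (\<forall>i. realizes_over (a i) (B \<union> (\<Union>j<i. set (a j))))"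

lemma morley_tuple: "morley B a \<Longrightarrow> a i \<in> T n"
  using realizes_over_tuple unfolding morley_def by blast

lemma morley_set: "morley B a \<Longrightarrow> set (a i) \<subseteq> Dom U"
  using morley_tuple[of B a i] by (simp add: tuples_def)

lemma morley_realizes_over:
  assumes "morley B a"
  shows "realizes_over (a i) B"
  by (rule realizes_over_mono[OF _ Un_upper1]) (rule assms[unfolded morley_def, rule_format])

lemma morley_sequence_iff_morley:
  assumes B: "B \<subseteq> Dom U"
  shows "morley_sequence U B n p a \<longleftrightarrow> morley B a"
proof
  assume a: "morley_sequence U B n p a"
  then have "set (a i) \<subseteq> Dom U" for i
    by (auto simp: morley_sequence_def realizes_def tuples_def)
  then have "B \<union> (\<Union>j<i. set (a j)) \<subseteq> Dom U" for i using B by blast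
  from realizes_iff_realizes_over[OF this] a show "morley B a" unfolding morley_def morley_sequence_def by simp
next
  assume a: "morley B a"
  have "B \<union> (\<Union>j<i. set (a j)) \<subseteq> Dom U" for i using B morley_set[OF a] by blast
  from realizes_iff_realizes_over[OF this] a show "morley_sequence U B n p a"
    unfolding morley_def morley_sequence_def by simp
qed

text \<open>Subsequences inherit the Morley condition because they leave fewer earlier terms to be
  independent of; decreasing indices put the latest term at the head, as \<open>morley_list\<close>
  requires.\<close>

lemma morley_list_of_morley:
  assumes "morley B a" "sorted_wrt (>) is"
  shows "morley_list B (map a is)"
  using assms(2)
proof (induction "is")
  case (Cons i "is")
  have "realizes_over (a i) (B \<union> \<Union> (set ` set (map a is)))"
  proof (rule realizes_over_mono)
    show "realizes_over (a i) (B \<union> (\<Union>j<i. set (a j)))" using assms(1) by (simp add: morley_def)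
    show "B \<union> \<Union> (set ` set (map a is)) \<subseteq> B \<union> (\<Union>j<i. set (a j))" using Cons.prems by auto
  qed
  with Cons show ?case by simp
qed simp

lemma sorted_rev_upt: "sorted_wrt (>) (rev [i..<j])"
  by (simp add: sorted_wrt_rev)

lemma ex_morley:
  assumes B: "small B"
  shows "\<exists>a. morley B a"
proof -
  have "\<exists>f :: nat \<Rightarrow> 'u list. \<forall>i. realizes_over (f i) (B \<union> (\<Union>j<i. set (f j)))"
  proof (rule dependent_wellorder_choice)
    fix r and f g :: "nat \<Rightarrow> 'u list" and i :: nat
    assume "\<And>j. j < i \<Longrightarrow> f j = g j"
    then have "(\<Union>j<i. set (f j)) = (\<Union>j<i. set (g j))" by simp
    then show "realizes_over r (B \<union> (\<Union>j<i. set (f j))) = realizes_over r (B \<union> (\<Union>j<i. set (g j)))" by simp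
  next
    fix i :: nat and f :: "nat \<Rightarrow> 'u list"
    assume *: "\<And>j. j < i \<Longrightarrow> realizes_over (f j) (B \<union> (\<Union>l<j. set (f l)))"
    have "set (map f [0..<i]) \<subseteq> T n" using realizes_over_tuple[OF *] by auto
    from small_Un[OF B small_tuples[OF this]]
    have "small (B \<union> (\<Union>j<i. set (f j)))" by (simp add: atLeast0LessThan image_image)
    then show "\<exists>r. realizes_over r (B \<union> (\<Union>j<i. set (f j)))" by (rule ex_realizes_over)
  qed
  then show ?thesis unfolding morley_def .
qed

definition limit :: "(nat \<Rightarrow> 'u list) \<Rightarrow> bool" where
  "limit a \<longleftrightarrow> (\<forall>P. definable (Dom U) n P \<longrightarrow> (in_type P \<longleftrightarrow> (\<forall>\<^sub>F i in sequentially. P (a i))))"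

lemma is_limit_type_iff_limit:
  assumes a: "\<And>i. a i \<in> T n"
  shows "is_limit_type L U n a p \<longleftrightarrow> limit a"
proof
  assume lim: "is_limit_type L U n a p"
  show "limit a"
    unfolding limit_def
  proof (intro allI impI)
    fix P assume "definable (Dom U) n P"
    then obtain \<phi> where \<phi>: "\<phi> \<in> Forms L (Dom U) {..<n}" "\<forall>a\<in>T n. holds U \<phi> a = P a"
      unfolding definable_def by (rule bexE)
    have "in_type P = in_type (holds U \<phi>)" using \<phi>(2) in_type_cong[of "holds U \<phi>" P] by simp
    also have "\<dots> = (\<forall>\<^sub>F i in sequentially. holds U \<phi> (a i))"
      using lim \<phi>(1) mem_iff_in_type[OF \<phi>(1)] unfolding is_limit_type_def by simp
    also have "(\<lambda>i. holds U \<phi> (a i)) = (\<lambda>i. P (a i))" using \<phi>(2) a by blast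
    finally show "in_type P \<longleftrightarrow> (\<forall>\<^sub>F i in sequentially. P (a i))" .
  qed
next
  assume lim: "limit a"
  show "is_limit_type L U n a p"
    unfolding is_limit_type_def
  proof
    fix \<phi> assume \<phi>: "\<phi> \<in> Forms L (Dom U) {..<n}"
    show "\<phi> \<in> p \<longleftrightarrow> (\<forall>\<^sub>F i in sequentially. holds U \<phi> (a i))"
      using lim definable_holds[OF \<phi>] mem_iff_in_type[OF \<phi>] unfolding limit_def by simp
  qed
qed

end

context invariant_type_model
begin

lemma totally_indiscernible_iff_eqtype:
  assumes a: "\<And>i. a i \<in> T n"
  shows "totally_indiscernible L U (Dom M) n a \<longleftrightarrow>
    (\<forall>is js. distinct is \<and> distinct js \<and> length is = length js \<longrightarrow>
      eqtype (Dom M) (length is * n) (concat (map a is)) (concat (map a js)))"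
proof
  assume ti: "totally_indiscernible L U (Dom M) n a"
  show "\<forall>is js. distinct is \<and> distinct js \<and> length is = length js \<longrightarrow>
      eqtype (Dom M) (length is * n) (concat (map a is)) (concat (map a js))"
  proof (intro allI impI)
    fix "is" js :: "nat list" assume d: "distinct is \<and> distinct js \<and> length is = length js"
    have T: "concat (map a ls) \<in> T (length ls * n)" for ls
    proof -
      have "set (map a ls) \<subseteq> T n" using a by auto
      from concat_tuples[OF this] show ?thesis by simp
    qed
    have T: "concat (map a is) \<in> T (length is * n)" "concat (map a js) \<in> T (length is * n)"
      using T[of "is"] T[of js] d by simp_all
    have "P (concat (map a is)) = P (concat (map a js))" if P: "definable (Dom M) (length is * n) P" for P
    proof -
      obtain \<phi> where \<phi>: "\<phi> \<in> Forms L (Dom M) {..<length is * n}"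
        "\<forall>a\<in>T (length is * n). holds U \<phi> a = P a"
        using P unfolding definable_def by (rule bexE)
      have "holds U \<phi> (concat (map a is)) = holds U \<phi> (concat (map a js))"
        using d ti[unfolded totally_indiscernible_def, THEN spec, THEN bspec, OF \<phi>(1)] by simp
      then show ?thesis using \<phi>(2)[rule_format, OF T(1)] \<phi>(2)[rule_format, OF T(2)] by simp
    qed
    with T show "eqtype (Dom M) (length is * n) (concat (map a is)) (concat (map a js))"
      unfolding eqtype_def by blast
  qed
next
  assume eq: "\<forall>is js. distinct is \<and> distinct js \<and> length is = length js \<longrightarrow>
      eqtype (Dom M) (length is * n) (concat (map a is)) (concat (map a js))"
  show "totally_indiscernible L U (Dom M) n a"
    unfolding totally_indiscernible_def
  proof (intro allI ballI impI)
    fix k \<phi> and "is" js :: "nat list"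
    assume \<phi>: "\<phi> \<in> Forms L (Dom M) {..<k * n}"
      and d: "length is = k \<and> distinct is \<and> length js = k \<and> distinct js"
    then have "eqtype (Dom M) (k * n) (concat (map a is)) (concat (map a js))"
      using eq[THEN spec, THEN spec, THEN mp, of "is" js] by simp
    from eqtypeD[OF this definable_holds[OF \<phi>]]
    show "holds U \<phi> (concat (map a is)) = holds U \<phi> (concat (map a js))" .
  qed
qed

text \<open>Infinitely many \<open>a\<^sub>i\<close> violating \<open>F(x, c\<^sub>0) \<in> p\<close>, followed by a Morley sequence over everything
  (all of whose members satisfy it), give by total indiscernibility every pattern of truth values of
  \<open>F\<close> along any Morley sequence over \<open>M\<close>.\<close>

lemma eventually_if_totally_indiscernible:
  assumes ti: "\<And>a. morley (Dom M) a \<Longrightarrow> totally_indiscernible L U (Dom M) n a"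
    and c: "morley (Dom M) c" "\<And>i. set (c i) \<subseteq> A" and nip: "eventually_NIP L U A"
    and a: "morley (Dom M) a" and P: "definable (Dom U) n P" "in_type P"
  shows "\<forall>\<^sub>F i in sequentially. P (a i)"
proof (rule ccontr)
  assume "\<not> ?thesis"
  then obtain r :: "nat \<Rightarrow> nat" where r: "strict_mono r" "\<And>i. \<not> P (a (r i))"
    using not_eventually_sequentiallyD by blast
  obtain c0 k F where c0: "c0 \<in> T k" and F: "definable {} (n + k) F"
    and PF: "\<And>x. x \<in> T n \<Longrightarrow> P x = F (x @ c0)"
    by (rule definable_unplug_finite[OF P(1)]) (rule that; simp)
  obtain \<phi> where \<phi>: "\<phi> \<in> Forms L {} {..<n + k}" and F\<phi>: "\<forall>z\<in>T (n + k). holds U \<phi> z = F z"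
    using F unfolding definable_def by (rule bexE)
  \<comment> \<open>Eventual NIP is usable for sequences in \<open>A\<close> only, so it is applied
    to \<open>c\<close>. The pattern it forbids there is first built on another sequence, with
    parameter \<open>c0\<close>, and then carried over to \<open>c\<close>.\<close>
  have nip_\<phi>: "eventually_NIP_fm U A n k \<phi>"
    using nip Forms_mono[OF \<phi> empty_subsetI] unfolding eventually_NIP_def by blast
  have "\<forall>i. c i \<in> tuples A n"
    using c(2) length_tuples[OF morley_tuple[OF c(1)]] by (simp add: tuples_def)
  from nip_\<phi>[unfolded eventually_NIP_fm_def, THEN spec, THEN mp, OF this]
  obtain q :: "nat \<Rightarrow> nat" and N E where q: "strict_mono q"
    and omit: "\<forall>i :: nat \<Rightarrow> nat. strict_mono_on {1..N} i \<longrightarrow> \<not> (\<exists>b\<in>T k.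
        (\<forall>j\<in>E. holds U \<phi> (c (q (i j)) @ b)) \<and> (\<forall>j\<in>{1..N} - E. \<not> holds U \<phi> (c (q (i j)) @ b)))"
      and E: "E \<subseteq> {1..N}"
    by (elim exE conjE) (rule that)
  \<comment> \<open>Containing \<open>c0\<close> makes every \<open>a' i\<close> satisfy
    \<open>P\<close>; containing all \<open>a i\<close> lets \<open>a'\<close> be appended to terms
    of \<open>a\<close>.\<close>
  define B where "B = Dom M \<union> (\<Union>i. set (a i)) \<union> set c0"
  have B: "small B" unfolding B_def
    using small_Un[OF small_Un[OF small_Dom_M small_UN_set[OF morley_set[OF a]]] small_tuple[OF c0]] .
  then obtain a' where a': "morley B a'" using ex_morley by blast
  \<comment> \<open>The entries at \<open>0, ..., N\<close> come from the subsequence that violates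
    \<open>P\<close>, and all later ones come from \<open>a'\<close> and satisfy
    \<open>P\<close>.\<close>
  define s where "s j = (if j \<le> N then a (r j) else a' (j - Suc N))" for j
  have s: "morley (Dom M) s"
    unfolding morley_def
  proof
    fix i
    show "realizes_over (s i) (Dom M \<union> (\<Union>j<i. set (s j)))"
    proof (cases "i \<le> N")
      case True
      have "realizes_over (a (r i)) (Dom M \<union> (\<Union>j<r i. set (a j)))" using a by (simp add: morley_def)
      moreover have "set (s j) \<subseteq> (\<Union>j<r i. set (a j))" if "j < i" for j
        using that True strict_monoD[OF r(1) that] by (auto simp: s_def)
      then have "Dom M \<union> (\<Union>j<i. set (s j)) \<subseteq> Dom M \<union> (\<Union>j<r i. set (a j))" by blast
      ultimately show ?thesis using True by (simp add: s_def realizes_over_mono)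
    next
      case False
      have "realizes_over (a' (i - Suc N)) (B \<union> (\<Union>j<i - Suc N. set (a' j)))" using a' by (simp add: morley_def)
      moreover have "set (s j) \<subseteq> B \<union> (\<Union>j<i - Suc N. set (a' j))" if "j < i" for j
      proof (cases "j \<le> N")
        case True
        then show ?thesis by (auto simp: s_def B_def)
      next
        case j: False
        then have "j - Suc N < i - Suc N" using that by simp
        then show ?thesis using j by (auto simp: s_def)
      qed
      then have "Dom M \<union> (\<Union>j<i. set (s j)) \<subseteq> B \<union> (\<Union>j<i - Suc N. set (a' j))"
        by (auto simp: B_def)
      ultimately show ?thesis using False by (simp add: s_def realizes_over_mono)
    qed
  qed
  define l0 where "l0 = [Suc 0..<Suc N]"
  \<comment> \<open>Positions run from \<open>1\<close> to \<open>N\<close>, as in eventual NIP. A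
    position outside \<open>E\<close> stays among the violating entries, and one in \<open>E\<close>
    is sent past \<open>Suc N\<close> to the satisfying ones. The two ranges are disjoint, so the
    chosen indices are distinct, though not increasing; this is where total indiscernibility is
    needed.\<close>
  define f where "f j = (if j \<in> E then Suc N + j else j)" for j
  have l0: "length l0 = N" "distinct l0" "set l0 = {Suc 0..N}"
    and l0_nth: "\<And>j. j < N \<Longrightarrow> l0 ! j = Suc j"
    by (auto simp: l0_def simp del: upt_Suc)
  have "inj_on f {Suc 0..N}"
    by (rule inj_onI) (auto simp: f_def split: if_splits)
  then have df: "distinct (map f l0)" using l0 by (simp add: distinct_map)
  have dq: "distinct (map q l0)"
    using l0 strict_mono_imp_inj_on[OF q] by (simp add: distinct_map inj_on_subset)
  have sq: "sorted_wrt (>) (map q (rev l0))"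
    unfolding sorted_wrt_map l0_def
    by (rule sorted_wrt_mono_rel[OF _ sorted_rev_upt]) (rule strict_monoD[OF q])
  have ti_eq: "eqtype (Dom M) (N * n) (concat (map t is)) (concat (map t js))"
    if t: "morley (Dom M) t" and "distinct is" "distinct js" "length is = N" "length js = N" for t "is" js
    using that totally_indiscernible_iff_eqtype[THEN iffD1, OF morley_tuple[OF t] ti[OF t],
        THEN spec, THEN spec, THEN mp, of "is" js] by simp
  \<comment> \<open>Three comparisons lead to \<open>c\<close>: total indiscernibility of
    \<open>s\<close> puts the chosen entries into Morley order, uniqueness of the type of a Morley
    list passes from \<open>s\<close> to \<open>c\<close>, and total indiscernibility of
    \<open>c\<close> restores increasing order.\<close>
  have eqs: "eqtype (Dom M) (N * n) (concat (map s (map f l0))) (concat (map s (rev l0)))"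
    by (rule ti_eq[OF s]) (use df l0 in simp_all)
  have "eqtype (Dom M) (length (map s (rev l0)) * n) (concat (map s (rev l0)))
      (concat (map c (map q (rev l0))))"
    using morley_list_of_morley[OF s sorted_rev_upt, of "Suc 0" "Suc N"] morley_list_of_morley[OF c(1) sq]
    by (intro morley_list_eqtype[OF small_Dom_M order_refl]) (simp_all add: l0_def)
  then have eqsc: "eqtype (Dom M) (N * n) (concat (map s (rev l0))) (concat (map c (map q (rev l0))))"
    using l0 by simp
  have eqc: "eqtype (Dom M) (N * n) (concat (map c (map q (rev l0)))) (concat (map c (map q l0)))"
    by (rule ti_eq[OF c(1)]) (use dq l0 in \<open>simp_all add: distinct_map\<close>)
  have xs: "set (map s (map f l0)) \<subseteq> T n" "length (map s (map f l0)) = N"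
    using morley_tuple[OF s] l0 by auto
  have ys: "set (map c (map q l0)) \<subseteq> T n" "length (map c (map q l0)) = N"
    using morley_tuple[OF c(1)] l0 by auto
  have y: "\<forall>j<N. F (map s (map f l0) ! j @ c0) = (Suc j \<in> E)"
  proof (intro allI impI)
    fix j assume j: "j < N"
    have "F (s (f (Suc j)) @ c0) = (Suc j \<in> E)"
    proof (cases "Suc j \<in> E")
      case True
      have "realizes_over (a' (Suc j)) (set c0)"
        using realizes_over_mono[OF morley_realizes_over[OF a']] by (simp add: B_def)
      moreover have c0': "c0 \<in> tuples (set c0) k" "set c0 \<subseteq> Dom U" using c0 by (auto simp: tuples_def)
      ultimately have "F (a' (Suc j) @ c0) = in_type (\<lambda>x. F (x @ c0))"
        using realizes_overD[OF _ definable_plug[OF F empty_subsetI c0'(2,1)]] by simp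
      also have "\<dots> = in_type P" using PF by (intro in_type_cong) simp
      finally show ?thesis using True P(2) by (simp add: s_def f_def)
    next
      case False
      then show ?thesis using r(2) PF[OF morley_tuple[OF a]] j by (simp add: s_def f_def)
    qed
    then show "F (map s (map f l0) ! j @ c0) = (Suc j \<in> E)" using j l0 l0_nth by simp
  qed
  from pattern_transfer[OF M_sub definable_mono[OF F empty_subsetI] definable_const[of _ _ True]
      eqtype_trans[OF eqtype_trans[OF eqs eqsc] eqc] xs ys c0 TrueI y]
  obtain y' where y': "y' \<in> T k" "\<forall>j<N. F (map c (map q l0) ! j @ y') = (Suc j \<in> E)"
    by (elim bexE conjE) (rule that)
  have pat: "holds U \<phi> (c (q j) @ y') = (j \<in> E)" if j: "j \<in> {1..N}" for j
  proof -
    obtain i where i: "j = Suc i" "i < N" using j by (cases j) auto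
    have "holds U \<phi> (c (q j) @ y') = F (c (q j) @ y')"
      using F\<phi> tuples_append[OF morley_tuple[OF c(1)] y'(1)] by blast
    then show ?thesis using y'(2) i l0 l0_nth by simp
  qed
  \<comment> \<open>The pattern \<open>E\<close> is forbidden for every increasing choice of
    indices, yet \<open>y'\<close> realizes it already at \<open>1, ..., N\<close>.\<close>
  have "strict_mono_on {1..N} (\<lambda>j. j :: nat)" by (simp add: strict_mono_on_def)
  from omit[rule_format, OF this] y'(1) pat E show False by blast
qed

text \<open>The preceding lemma is applied to \<open>P\<close> and also to its negation: if
  \<open>P\<close> is not in \<open>p\<close>, its negation holds eventually, so \<open>P\<close>
  cannot.\<close>

lemma limit_if_totally_indiscernible:
  assumes ti: "\<And>a. morley (Dom M) a \<Longrightarrow> totally_indiscernible L U (Dom M) n a"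
    and c: "morley (Dom M) c" "\<And>i. set (c i) \<subseteq> A" and nip: "eventually_NIP L U A"
    and a: "morley (Dom M) a"
  shows "limit a"
  unfolding limit_def
proof (intro allI impI)
  fix P assume P: "definable (Dom U) n P"
  have ev: "\<forall>\<^sub>F i in sequentially. Q (a i)" if "definable (Dom U) n Q" "in_type Q" for Q
    by (rule eventually_if_totally_indiscernible[OF _ c nip a that]) (rule ti)
  have "\<not> (\<forall>\<^sub>F i in sequentially. P (a i))" if "\<not> in_type P"
  proof
    assume "\<forall>\<^sub>F i in sequentially. P (a i)"
    moreover have "\<forall>\<^sub>F i in sequentially. \<not> P (a i)"
      using that in_type_not[OF P] by (intro ev[OF definable_not[OF P]]) simp
    ultimately have "\<forall>\<^sub>F i :: nat in sequentially. False" by eventually_elim simp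
    then show False by simp
  qed
  with ev[OF P] show "in_type P \<longleftrightarrow> (\<forall>\<^sub>F i in sequentially. P (a i))" by blast
qed

end

section \<open>Limits of Morley sequences\<close>

lemma (in monster_model) finite_unrealized:
  assumes A: "small A" and definable: "\<And>P. P \<in> \<F> \<Longrightarrow> definable A k P"
    and unsat: "\<not> (\<exists>a\<in>T k. \<forall>P\<in>\<F>. P a)"
  obtains \<G> where "\<G> \<subseteq> \<F>" "finite \<G>" "\<not> (\<exists>a\<in>T k. \<forall>P\<in>\<G>. P a)"
proof (rule ccontr)
  assume no: "\<not> thesis"
  have "\<exists>a\<in>T k. \<forall>P\<in>\<F>. P a"
  proof (rule realize_family[OF A definable])
    fix \<G> assume "\<G> \<subseteq> \<F>" "finite \<G>"
    show "\<exists>a\<in>T k. \<forall>P\<in>\<G>. P a"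
    proof (rule ccontr)
      assume "\<not> ?thesis"
      from that[OF \<open>\<G> \<subseteq> \<F>\<close> \<open>finite \<G>\<close> this] no show False by (rule notE[rotated])
    qed
  qed
  with unsat show False by (rule notE)
qed

context invariant_type_model
begin

lemma definable_over_iff:
  "definable_over L U (Dom M) n p \<longleftrightarrow>
    (\<forall>k F. definable {} (n + k) F \<longrightarrow> definable (Dom M) k (\<lambda>y. in_type (\<lambda>x. F (x @ y))))"
proof -
  have plug: "plug n b \<phi> \<in> p \<longleftrightarrow> in_type (\<lambda>x. F (x @ b))"
    if \<phi>: "\<phi> \<in> Forms L {} {..<n + k}" and F: "\<forall>z\<in>T (n + k). holds U \<phi> z = F z" and b: "b \<in> T k"
    for \<phi> F k b
  proof -
    have "plug n b \<phi> \<in> Forms L (Dom U) {..<n}" using plug_Forms[OF \<phi> b] by simp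
    then have "plug n b \<phi> \<in> p \<longleftrightarrow> in_type (holds U (plug n b \<phi>))" by (rule mem_iff_in_type)
    also have "\<dots> \<longleftrightarrow> in_type (\<lambda>x. F (x @ b))"
    proof (rule in_type_cong)
      fix a assume a: "a \<in> T n"
      have "holds U (plug n b \<phi>) a = holds U \<phi> (a @ b)"
        using \<phi> length_tuples[OF a] length_tuples[OF b]
        by (intro holds_plug[where k = k]) (simp_all add: Forms_def)
      also have "\<dots> = F (a @ b)" by (rule F[rule_format, OF tuples_append[OF a b]])
      finally show "holds U (plug n b \<phi>) a = F (a @ b)" .
    qed
    finally show ?thesis .
  qed
  show ?thesis
  proof
    assume def: "definable_over L U (Dom M) n p"
    show "\<forall>k F. definable {} (n + k) F \<longrightarrow> definable (Dom M) k (\<lambda>y. in_type (\<lambda>x. F (x @ y)))"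
    proof (intro allI impI)
      fix k F assume "definable {} (n + k) F"
      then obtain \<phi> where \<phi>: "\<phi> \<in> Forms L {} {..<n + k}" "\<forall>z\<in>T (n + k). holds U \<phi> z = F z"
        unfolding definable_def by (rule bexE)
      from def[unfolded definable_over_def, THEN spec, THEN bspec, OF \<phi>(1)]
      obtain \<psi> where \<psi>: "\<psi> \<in> Forms L (Dom M) {..<k}" "\<forall>b\<in>T k. plug n b \<phi> \<in> p \<longleftrightarrow> holds U \<psi> b"
        by (rule bexE)
      have "\<forall>b\<in>T k. holds U \<psi> b = in_type (\<lambda>x. F (x @ b))"
        using \<psi>(2) plug[OF \<phi>] by simp
      with \<psi>(1) show "definable (Dom M) k (\<lambda>y. in_type (\<lambda>x. F (x @ y)))"
        unfolding definable_def by (rule bexI[rotated])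
    qed
  next
    assume def: "\<forall>k F. definable {} (n + k) F \<longrightarrow> definable (Dom M) k (\<lambda>y. in_type (\<lambda>x. F (x @ y)))"
    show "definable_over L U (Dom M) n p"
      unfolding definable_over_def
    proof (intro allI ballI)
      fix k and \<phi> :: "('f, 'r, 'u) fm" assume \<phi>: "\<phi> \<in> Forms L {} {..<n + k}"
      from def[THEN spec, THEN spec, THEN mp, OF definable_holds[OF \<phi>], unfolded definable_def]
      obtain \<psi> where \<psi>: "\<psi> \<in> Forms L (Dom M) {..<k}"
        "\<forall>b\<in>T k. holds U \<psi> b = in_type (\<lambda>x. holds U \<phi> (x @ b))"
        by (rule bexE)
      have "\<forall>b\<in>T k. plug n b \<phi> \<in> p \<longleftrightarrow> holds U \<psi> b"
        using \<psi>(2) plug[OF \<phi>, of "holds U \<phi>"] by simp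
      with \<psi>(1) show "\<exists>\<psi>\<in>Forms L (Dom M) {..<k}. \<forall>b\<in>T k. plug n b \<phi> \<in> p \<longleftrightarrow> holds U \<psi> b"
        by (rule bexI[rotated])
    qed
  qed
qed

lemma finitely_satisfiable_iff:
  "finitely_satisfiable_in U (Dom M) n p \<longleftrightarrow>
    (\<forall>P. definable (Dom U) n P \<longrightarrow> in_type P \<longrightarrow> (\<exists>m\<in>tuples (Dom M) n. P m))"
proof
  assume fs: "finitely_satisfiable_in U (Dom M) n p"
  show "\<forall>P. definable (Dom U) n P \<longrightarrow> in_type P \<longrightarrow> (\<exists>m\<in>tuples (Dom M) n. P m)"
  proof (intro allI impI)
    fix P assume "in_type P"
    then obtain \<phi> where \<phi>: "\<phi> \<in> p" "\<forall>a\<in>T n. holds U \<phi> a = P a"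
      unfolding in_type_def by (rule bexE)
    from fs[unfolded finitely_satisfiable_in_def, THEN bspec, OF \<phi>(1)]
    obtain m where m: "m \<in> tuples (Dom M) n" "holds U \<phi> m" by (rule bexE)
    then have "P m" using \<phi>(2) tuples_mono[OF M_sub m(1)] by blast
    with m(1) show "\<exists>m\<in>tuples (Dom M) n. P m" by blast
  qed
next
  assume fs: "\<forall>P. definable (Dom U) n P \<longrightarrow> in_type P \<longrightarrow> (\<exists>m\<in>tuples (Dom M) n. P m)"
  show "finitely_satisfiable_in U (Dom M) n p"
    unfolding finitely_satisfiable_in_def
  proof
    fix \<phi> assume \<phi>: "\<phi> \<in> p"
    note F = p_Forms[OF \<phi>]
    show "\<exists>a\<in>tuples (Dom M) n. holds U \<phi> a"
      using fs[THEN spec, THEN mp, OF definable_holds[OF F]] \<phi> mem_iff_in_type[OF F] by simp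
  qed
qed

text \<open>A realization of \<open>tp(b/M)\<close> all of whose \<open>F(a\<^sub>i, y)\<close> fail would contradict the invariance of
  \<open>p\<close>; finitely many failures are obtained from a Morley sequence over a parameter \<open>b'\<close> with
  \<open>F(x, b') \<notin> p\<close>.\<close>

lemma limit_open:
  assumes a: "morley (Dom M) a" "limit a" and F: "definable {} (n + k) F"
    and b: "b \<in> T k" "in_type (\<lambda>x. F (x @ b))"
  shows "\<exists>\<chi>. definable (Dom M) k \<chi> \<and> \<chi> b \<and> (\<forall>b'\<in>T k. \<chi> b' \<longrightarrow> in_type (\<lambda>x. F (x @ b')))"
proof (rule ccontr)
  assume "\<not> ?thesis"
  then have near: "\<exists>b'\<in>T k. \<chi> b' \<and> \<not> in_type (\<lambda>x. F (x @ b'))" if "definable (Dom M) k \<chi>" "\<chi> b" for \<chi>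
    using that by auto
  define A where "A = Dom M \<union> (\<Union>i. set (a i))"
  have A: "small A"
    unfolding A_def using small_Un[OF small_Dom_M small_UN_set[OF morley_set[OF a(1)]]] .
  define G where "G i = (\<lambda>y. \<not> F (a i @ y))" for i
  define \<F> where "\<F> = {\<chi>. definable (Dom M) k \<chi> \<and> \<chi> b}"
  have "\<exists>b''\<in>T k. \<forall>\<chi>\<in>\<F> \<union> range G. \<chi> b''"
  proof (rule realize_family[OF A])
    fix P assume "P \<in> \<F> \<union> range G"
    then show "definable A k P"
    proof
      assume "P \<in> \<F>"
      then have "definable (Dom M) k P" by (simp add: \<F>_def)
      then show ?thesis by (rule definable_mono) (simp add: A_def)
    next
      assume "P \<in> range G"
      then obtain i where P: "P = G i" by (rule rangeE)
      have "a i \<in> tuples A n" using length_tuples[OF morley_tuple[OF a(1)]] by (auto simp: A_def tuples_def)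
      from definable_not[OF definable_plug_left[OF F empty_subsetI small_Dom[OF A] this]]
      show ?thesis unfolding P G_def .
    qed
  next
    fix \<G> assume \<G>: "\<G> \<subseteq> \<F> \<union> range G" "finite \<G>"
    define \<chi>0 where "\<chi>0 y \<longleftrightarrow> (\<forall>\<chi>\<in>\<G> \<inter> \<F>. \<chi> y)" for y
    have \<chi>0: "definable (Dom M) k \<chi>0"
      unfolding \<chi>0_def using \<G>(2) by (intro definable_ball) (auto simp: \<F>_def)
    have "\<chi>0 b" by (auto simp: \<chi>0_def \<F>_def)
    from near[OF \<chi>0 this] obtain b' where b': "b' \<in> T k" "\<chi>0 b'" "\<not> in_type (\<lambda>x. F (x @ b'))"
      by (elim bexE conjE) (rule that)
    have "finite (\<G> - \<F>)" "\<G> - \<F> \<subseteq> G ` UNIV" using \<G> by auto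
    then obtain I where I: "finite I" "\<G> - \<F> = G ` I"
      using finite_subset_image[of "\<G> - \<F>" G UNIV] by blast
    obtain N where N: "\<And>i. i \<in> I \<Longrightarrow> i < N"
      using finite_nat_set_iff_bounded[THEN iffD1, OF I(1)] by blast
    obtain xs where xs: "morley_list (Dom M \<union> set b') xs" "length xs = N"
      using ex_morley_list[OF small_Un[OF small_Dom_M small_tuple[OF b'(1)]]] by blast
    have b'': "b' \<in> tuples (set b') k" "set b' \<subseteq> Dom U" using b'(1) by (auto simp: tuples_def)
    have xs_F: "F (xs ! j @ b') = False" if "j < N" for j
    proof -
      have "xs ! j \<in> set xs" using that xs(2) by simp
      from realizes_over_mono[OF morley_list_realizes_over[OF xs(1) this] Un_upper2] have "realizes_over (xs ! j) (set b')" .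
      from realizes_overD[OF this definable_plug[OF F empty_subsetI b''(2,1)] b''(2)] b'(3) show ?thesis by simp
    qed
    define ys where "ys = map a (rev [0..<N])"
    have ys: "morley_list (Dom M) ys" unfolding ys_def by (rule morley_list_of_morley[OF a(1) sorted_rev_upt])
    have len: "length ys = N" by (simp add: ys_def)
    have xsM: "morley_list (Dom M) xs" by (rule morley_list_mono[OF xs(1) Un_upper1])
    \<comment> \<open>Failure of \<open>F\<close> along a finite list for some \<open>y\<close>
      satisfying \<open>\<chi>0\<close> is a condition on the type of that list over
      \<open>M\<close>. So \<open>xs\<close>, whose entries fail together with \<open>b'\<close>,
      can be traded for the given \<open>a\<close> at the cost of replacing \<open>b'\<close> by a
      new \<open>y\<close>.\<close>
    have eq: "eqtype (Dom M) (N * n) (concat xs) (concat ys)"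
      using morley_list_eqtype[OF small_Dom_M order_refl _ xsM ys] xs(2) len by simp
    from pattern_transfer[OF M_sub definable_mono[OF F empty_subsetI] \<chi>0 eq morley_list_tuples[OF xsM] xs(2)
        morley_list_tuples[OF ys] len b'(1,2), of "\<lambda>_. False"] xs_F
    obtain y where y: "y \<in> T k" "\<chi>0 y" "\<forall>j<N. F (ys ! j @ y) = False"
      by auto
    have "\<chi> y" if \<chi>: "\<chi> \<in> \<G>" for \<chi>
    proof (cases "\<chi> \<in> \<F>")
      case True
      then show ?thesis using y(2) \<chi> unfolding \<chi>0_def by blast
    next
      case False
      then obtain i where i: "i \<in> I" "\<chi> = G i" using \<chi> I(2) by blast
      \<comment> \<open>\<open>ys\<close> lists the first \<open>N\<close> terms in reverse, hence
        the index shift.\<close>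
      have "ys ! (N - Suc i) = a i" using N[OF i(1)] by (simp add: ys_def rev_nth)
      then show ?thesis using y(3)[rule_format, of "N - Suc i"] N[OF i(1)] by (simp add: i(2) G_def)
    qed
    then show "\<exists>y\<in>T k. \<forall>\<chi>\<in>\<G>. \<chi> y" by (intro bexI[OF _ y(1)] ballI)
  qed
  then obtain b'' where b'': "b'' \<in> T k" "\<forall>\<chi>\<in>\<F> \<union> range G. \<chi> b''" by (rule bexE)
  \<comment> \<open>For each predicate definable over \<open>M\<close>, either it or its complement
    belongs to \<open>\<F>\<close>, so \<open>b''\<close> realizes the whole type of
    \<open>b\<close>.\<close>
  have "P b = P b''" if P: "definable (Dom M) k P" for P
  proof (cases "P b")
    case True
    then have "P \<in> \<F>" using P by (simp add: \<F>_def)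
    from bspec[OF b''(2) UnI1[OF this]] True show ?thesis by simp
  next
    case False
    then have "(\<lambda>y. \<not> P y) \<in> \<F>" using definable_not[OF P] by (simp add: \<F>_def)
    from bspec[OF b''(2) UnI1[OF this]] False show ?thesis by simp
  qed
  then have "eqtype (Dom M) k b b''" using b(1) b''(1) unfolding eqtype_def by blast
  from in_type_invariant[OF small_Dom_M order_refl this definable_mono[OF F empty_subsetI]] b(2)
  have in_type: "in_type (\<lambda>x. F (x @ b''))" by simp
  have "definable (Dom U) n (\<lambda>x. F (x @ b''))" by (rule definable_plug[OF F empty_subsetI order_refl b''(1)])
  with a(2) in_type have "\<forall>\<^sub>F i in sequentially. F (a i @ b'')" unfolding limit_def by blast
  moreover have "\<not> F (a i @ b'')" for i
  proof -
    have "G i b''" by (rule bspec[OF b''(2) UnI2[OF rangeI]])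
    then show ?thesis by (simp add: G_def)
  qed
  ultimately show False by simp
qed

text \<open>Openness for \<open>F\<close> and for its negation makes \<open>D\<close> locally
  constant in the topology generated by \<open>M\<close>-definable sets. Saturation makes this
  topology compact, so finitely many such sets decide \<open>D\<close>.\<close>

lemma limit_definable:
  assumes a: "morley (Dom M) a" "limit a" and F: "definable {} (n + k) F"
  shows "definable (Dom M) k (\<lambda>y. in_type (\<lambda>x. F (x @ y)))"
proof -
  define D where "D y = in_type (\<lambda>x. F (x @ y))" for y
  have D_not: "in_type (\<lambda>x. \<not> F (x @ y)) \<longleftrightarrow> \<not> D y" if "y \<in> T k" for y
    unfolding D_def by (rule in_type_not[OF definable_plug[OF F empty_subsetI order_refl that]])
  \<comment> \<open>Members of \<open>\<F>\<close> are complements of sets on which \<open>D\<close>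
    is constant; a covering by such sets thus becomes an inconsistent family, to which compactness
    applies.\<close>
  define \<F> where "\<F> = {\<chi>. definable (Dom M) k \<chi> \<and> (\<exists>c. \<forall>y\<in>T k. \<not> \<chi> y \<longrightarrow> D y = c)}"
  have "\<exists>\<chi>\<in>\<F>. \<not> \<chi> b" if b: "b \<in> T k" for b
  proof -
    have "\<exists>\<chi>. definable (Dom M) k \<chi> \<and> \<chi> b \<and> (\<forall>y\<in>T k. \<chi> y \<longrightarrow> D y = D b)"
    proof (cases "D b")
      case True
      then show ?thesis using limit_open[OF a F b] by (simp add: D_def)
    next
      case False
      then have "in_type (\<lambda>x. \<not> F (x @ b))" using D_not[OF b] by simp
      from limit_open[OF a definable_not[OF F] b this]
      obtain \<chi> where "definable (Dom M) k \<chi>" "\<chi> b" "\<forall>y\<in>T k. \<chi> y \<longrightarrow> in_type (\<lambda>x. \<not> F (x @ y))"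
        by (elim exE conjE) (rule that)
      moreover have "\<forall>y\<in>T k. \<chi> y \<longrightarrow> D y = D b"
        using calculation(3) False D_not by simp
      ultimately show ?thesis by (intro exI[of _ \<chi>] conjI)
    qed
    then obtain \<chi> where \<chi>: "definable (Dom M) k \<chi>" "\<chi> b" "\<forall>y\<in>T k. \<chi> y \<longrightarrow> D y = D b"
      by (elim exE conjE) (rule that)
    have "\<exists>c. \<forall>y\<in>T k. \<not> \<not> \<chi> y \<longrightarrow> D y = c" using \<chi>(3) by (intro exI[of _ "D b"]) simp
    with definable_not[OF \<chi>(1)] have "(\<lambda>y. \<not> \<chi> y) \<in> \<F>" by (simp add: \<F>_def)
    then show ?thesis by (rule bexI[rotated]) (simp add: \<chi>(2))
  qed
  then have unsat: "\<not> (\<exists>b\<in>T k. \<forall>\<chi>\<in>\<F>. \<chi> b)" by blast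
  have definable_\<F>: "definable (Dom M) k \<chi>" if "\<chi> \<in> \<F>" for \<chi> using that by (simp add: \<F>_def)
  obtain \<G> where \<G>: "\<G> \<subseteq> \<F>" "finite \<G>" and cover: "\<not> (\<exists>b\<in>T k. \<forall>\<chi>\<in>\<G>. \<chi> b)"
    by (rule finite_unrealized[OF small_Dom_M definable_\<F> unsat])
  \<comment> \<open>Of the finitely many sets covering \<open>T k\<close>, those contained in
    \<open>D\<close> have union \<open>D\<close>.\<close>
  define \<H> where "\<H> = {\<chi>\<in>\<G>. \<forall>y\<in>T k. \<not> \<chi> y \<longrightarrow> D y}"
  have "definable (Dom M) k (\<lambda>y. \<exists>\<chi>\<in>\<H>. \<not> \<chi> y)"
    using \<G> by (intro definable_bex definable_not) (auto simp: \<H>_def \<F>_def)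
  moreover have "D y \<longleftrightarrow> (\<exists>\<chi>\<in>\<H>. \<not> \<chi> y)" if y: "y \<in> T k" for y
  proof
    assume "D y"
    obtain \<chi> where \<chi>: "\<chi> \<in> \<G>" "\<not> \<chi> y" using cover y by blast
    then obtain c where "\<forall>y\<in>T k. \<not> \<chi> y \<longrightarrow> D y = c" using \<G>(1) by (auto simp: \<F>_def)
    then have "\<chi> \<in> \<H>" using \<chi> y \<open>D y\<close> by (simp add: \<H>_def)
    with \<chi>(2) show "\<exists>\<chi>\<in>\<H>. \<not> \<chi> y" by blast
  next
    assume "\<exists>\<chi>\<in>\<H>. \<not> \<chi> y"
    then show "D y" using y by (auto simp: \<H>_def)
  qed
  ultimately have "definable (Dom M) k D" by (simp add: definable_def)
  then show ?thesis unfolding D_def .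
qed

text \<open>The parameter \<open>b\<close> may lie outside \<open>M\<close>, so the argument is made
  uniform in it: finitely many \<open>a i\<close> are found such that every \<open>y\<close> in
  \<open>D\<close> makes \<open>F\<close> true at one of them. As \<open>D\<close> is definable over
  \<open>M\<close>, so is this property of the tuples, and it can be met inside \<open>M\<close>. In
  the end \<open>b\<close> is one of the \<open>y\<close>.\<close>

lemma limit_finitely_satisfiable:
  assumes a: "morley (Dom M) a" "limit a" and P: "definable (Dom U) n P" "in_type P"
  shows "\<exists>m\<in>tuples (Dom M) n. P m"
proof -
  obtain b k F where b: "b \<in> T k" and F: "definable {} (n + k) F"
    and PF: "\<And>x. x \<in> T n \<Longrightarrow> P x = F (x @ b)"
    by (rule definable_unplug_finite[OF P(1)]) (rule that; simp)
  define D where "D y = in_type (\<lambda>x. F (x @ y))" for y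
  have D: "definable (Dom M) k D" unfolding D_def by (rule limit_definable[OF a F])
  define A where "A = Dom M \<union> (\<Union>i. set (a i))"
  have A: "small A"
    unfolding A_def using small_Un[OF small_Dom_M small_UN_set[OF morley_set[OF a(1)]]] .
  define G where "G i = (\<lambda>y. \<not> F (a i @ y))" for i
  have definable_DG: "definable A k Q" if "Q \<in> insert D (range G)" for Q
    using that
  proof
    assume "Q = D"
    then show ?thesis using definable_mono[OF D, of A] by (simp add: A_def)
  next
    assume "Q \<in> range G"
    then obtain i where Q: "Q = G i" by (rule rangeE)
    have "a i \<in> tuples A n" using length_tuples[OF morley_tuple[OF a(1)]] by (auto simp: A_def tuples_def)
    from definable_not[OF definable_plug_left[OF F empty_subsetI small_Dom[OF A] this]]
    show ?thesis unfolding Q G_def .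
  qed
  have no_y: "\<not> (\<exists>y\<in>T k. \<forall>Q\<in>insert D (range G). Q y)"
  proof
    assume "\<exists>y\<in>T k. \<forall>Q\<in>insert D (range G). Q y"
    then obtain y where y: "y \<in> T k" "D y" "\<And>i. G i y" by auto
    have "definable (Dom U) n (\<lambda>x. F (x @ y))" by (rule definable_plug[OF F empty_subsetI order_refl y(1)])
    with a(2) y(2) have "\<forall>\<^sub>F i in sequentially. F (a i @ y)" unfolding limit_def D_def by blast
    then show False using y(3) by (simp add: G_def)
  qed
  obtain \<G> where \<G>: "\<G> \<subseteq> insert D (range G)" "finite \<G>" and unsat: "\<not> (\<exists>y\<in>T k. \<forall>Q\<in>\<G>. Q y)"
    by (rule finite_unrealized[OF A definable_DG no_y])
  have "finite (\<G> - {D})" "\<G> - {D} \<subseteq> G ` UNIV" using \<G> by auto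
  then obtain I where I: "finite I" "\<G> - {D} = G ` I"
    using finite_subset_image[of "\<G> - {D}" G UNIV] by blast
  obtain N where N: "\<And>i. i \<in> I \<Longrightarrow> i < N"
    using finite_nat_set_iff_bounded[THEN iffD1, OF I(1)] by blast
  define xs where "xs = map a [0..<N]"
  have xs: "set xs \<subseteq> T n" "length xs = N" using morley_tuple[OF a(1)] by (auto simp: xs_def)
  \<comment> \<open>\<open>R z\<close> says that some \<open>y\<close> in \<open>D\<close> defeats
    all \<open>N\<close> blocks of \<open>z\<close>. It mentions neither \<open>b\<close> nor the
    sequence, so its failure at the sequence can be reflected into \<open>M\<close>.\<close>
  define R where
    "R z \<longleftrightarrow> (\<exists>y\<in>T k. D y \<and> (\<forall>j<N. F (take n (drop (j * n) z) @ y) = False))" for z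
  have R: "definable (Dom M) (N * n) R"
    unfolding R_def by (rule definable_pattern[OF M_sub definable_mono[OF F empty_subsetI] D])
  have "\<not> R (concat xs)"
  proof
    assume "R (concat xs)"
    then obtain y where y: "y \<in> T k" "D y"
      and "\<forall>j<N. F (take n (drop (j * n) (concat xs)) @ y) = False"
      unfolding R_def by (elim bexE conjE) (rule that)
    then have y': "\<forall>j<N. F (xs ! j @ y) = False"
      using pattern_concat[OF xs, of F y "\<lambda>_. False"] by blast
    have "Q y" if Q: "Q \<in> \<G>" for Q
    proof (cases "Q = D")
      case False
      then obtain i where i: "i \<in> I" "Q = G i" using Q I(2) by blast
      then show ?thesis using y' N[OF i(1)] by (simp add: G_def xs_def)
    qed (simp add: y(2))
    with unsat y(1) show False by blast
  qed
  with tarski_vaught[OF definable_not[OF R], of "concat xs"] concat_tuples[OF xs(1)] xs(2)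
  obtain m where m: "m \<in> tuples (Dom M) (N * n)" "\<not> R m" by auto
  have "D b" unfolding D_def using P(2) in_type_cong[of P "\<lambda>x. F (x @ b)"] PF by simp
  with m(2) b obtain j where j: "j < N" "F (take n (drop (j * n) m) @ b)"
    unfolding R_def by blast
  have "j * n + n \<le> N * n" using mult_le_mono1[of "Suc j" N n] j(1) by simp
  then have len: "length (take n (drop (j * n) m)) = n" using length_tuples[OF m(1)] by simp
  have "set (take n (drop (j * n) m)) \<subseteq> set m" by (meson order_trans set_drop_subset set_take_subset)
  with len m(1) have mem: "take n (drop (j * n) m) \<in> tuples (Dom M) n" by (auto simp: tuples_def)
  from PF[OF tuples_mono[OF M_sub mem]] j(2) mem show ?thesis by blast
qed

end

section \<open>The Morley product\<close>

context invariant_type_model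
begin

text \<open>Suppose \<open>Q(a', b')\<close> fails. By definability the set of \<open>y\<close> with
  \<open>Q(x, y)\<close> in \<open>p\<close> is definable over \<open>B\<close>, and it belongs to
  \<open>p\<close> because of \<open>(a, b)\<close>; the negation of \<open>Q(a', y)\<close> belongs
  to \<open>p\<close> because of \<open>b'\<close>. Finite satisfiability gives \<open>m\<close> in
  \<open>M\<close> meeting both. Then \<open>Q(x, m)\<close> is in \<open>p\<close> and fails at
  \<open>a'\<close>, although \<open>a'\<close> realizes \<open>p\<close> over
  \<open>B\<close>.\<close>

lemma morley_pair_commutes:
  assumes def: "definable_over L U (Dom M) n p" and fs: "finitely_satisfiable_in U (Dom M) n p"
    and B: "small B" "Dom M \<subseteq> B"
    and ab: "realizes_over b B" "realizes_over a (B \<union> set b)" and ab': "realizes_over a' B" "realizes_over b' (B \<union> set a')"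
    and Q: "definable B (n + n) Q" and Qab: "Q (a @ b)"
  shows "Q (a' @ b')"
proof (rule ccontr)
  assume neg: "\<not> Q (a' @ b')"
  have BU: "B \<subseteq> Dom U" using B(1) by (rule small_Dom)
  have T: "a \<in> T n" "b \<in> T n" "a' \<in> T n" "b' \<in> T n" using ab ab' by (auto dest: realizes_over_tuple)
  have BbU: "B \<union> set b \<subseteq> Dom U" and BaU: "B \<union> set a' \<subseteq> Dom U"
    using BU T by (auto simp: tuples_def)
  obtain c l G where c: "c \<in> tuples B l" and G: "definable {} (n + n + l) G"
    and QG: "\<And>z. z \<in> T (n + n) \<Longrightarrow> Q z = G (z @ c)"
    by (rule definable_unplug_finite[OF Q]) (rule that; simp)
  have G': "definable {} (n + (n + l)) G" using G by (simp add: add.assoc)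
  define D where "D y = in_type (\<lambda>x. G (x @ y))" for y
  have D: "definable (Dom M) (n + l) D"
    unfolding D_def by (rule def[unfolded definable_over_iff, THEN spec, THEN spec, THEN mp, OF G'])
  have D_iff: "D (y @ c) \<longleftrightarrow> in_type (\<lambda>x. Q (x @ y))" if "y \<in> T n" for y
    unfolding D_def
  proof (rule in_type_cong)
    fix x assume "x \<in> T n"
    from QG[OF tuples_append[OF this that]] show "G (x @ y @ c) = Q (x @ y)" by simp
  qed
  have Dc: "definable B n (\<lambda>y. D (y @ c))" by (rule definable_plug[OF D B(2) BU c])
  have "b \<in> tuples (B \<union> set b) n" using T(2) by (auto simp: tuples_def)
  from realizes_overD[OF ab(2) definable_plug[OF Q Un_upper1 BbU this] BbU] Qab
  have "D (b @ c)" using D_iff[OF T(2)] by simp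
  then have pD: "in_type (\<lambda>y. D (y @ c))" using realizes_overD[OF ab(1) Dc BU] by simp
  have "a' \<in> tuples (B \<union> set a') n" using T(3) by (auto simp: tuples_def)
  note Qa = definable_not[OF definable_plug_left[OF Q Un_upper1 BaU this]]
  have pQ: "in_type (\<lambda>y. \<not> Q (a' @ y))" using realizes_overD[OF ab'(2) Qa BaU] neg by simp
  have "in_type (\<lambda>y. D (y @ c) \<and> \<not> Q (a' @ y))"
    by (rule in_type_conj[OF definable_mono[OF Dc BU] definable_mono[OF Qa BaU] pD pQ])
  with fs[unfolded finitely_satisfiable_iff, THEN spec, THEN mp,
      OF definable_conj[OF definable_mono[OF Dc BU] definable_mono[OF Qa BaU]]]
  obtain m where m: "m \<in> tuples (Dom M) n" "D (m @ c)" "\<not> Q (a' @ m)" by auto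
  have mB: "m \<in> tuples B n" by (rule tuples_mono[OF B(2) m(1)])
  have "in_type (\<lambda>x. Q (x @ m))" using m(2) D_iff[OF tuples_mono[OF BU mB]] by simp
  with realizes_overD[OF ab'(1) definable_plug[OF Q order_refl BU mB] BU] m(3) show False by simp
qed

text \<open>The definition quantifies over all small \<open>B\<close> and all realizations, but one
  realization decides membership: any two are Morley lists of length two, with the same type over a
  common base. The variable lists are kept general so that both orders of the product are
  covered.\<close>

lemma morley_product_iff:
  assumes xs: "length xs = n" and ys: "length ys = n" and V: "set xs \<union> set ys = {..<n + n}"
    and \<theta>: "\<theta> \<in> Forms L (Dom U) {..<n + n}" and B: "small B" "Dom M \<union> pars \<theta> \<subseteq> B"
    and e: "realizes_over (map e ys) B" "realizes_over (map e xs) (B \<union> e ` set ys)"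
  shows "\<theta> \<in> morley_product L \<kappa> U (Dom M) xs p ys p \<longleftrightarrow> sat U e \<theta>"
proof -
  \<comment> \<open>The smallest admissible base lies inside every other one, so realizations over
    different bases can be compared over it.\<close>
  define B0 where "B0 = Dom M \<union> pars \<theta>"
  have B0B: "B0 \<subseteq> B" using B(2) by (simp add: B0_def)
  have B0: "small B0" "Dom M \<subseteq> B0"
    using small_Dom[OF B(1)] B0B ordLeq_ordLess_trans[OF card_of_mono1[OF B0B]] B(1)
    by (auto simp: B0_def small_def)
  have "\<exists>l. l < n + n \<and> (xs @ ys) ! l = i" if i: "i < n + n" for i
  proof -
    have "i \<in> set (xs @ ys)" using i V by simp
    then obtain l where "l < length (xs @ ys)" "(xs @ ys) ! l = i" unfolding in_set_conv_nth by blast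
    then show ?thesis using xs ys by auto
  qed
  then obtain f where f: "\<And>i. i < n + n \<Longrightarrow> f i < n + n" "\<And>i. i < n + n \<Longrightarrow> (xs @ ys) ! f i = i"
    by metis
  \<comment> \<open>Values arrive in the order \<open>xs\<close>, \<open>ys\<close>;
    \<open>g\<close> restores the order of the variables of \<open>\<theta>\<close>.\<close>
  define g where "g w = map (\<lambda>i. w ! f i) [0..<n + n]" for w :: "'u list"
  have "\<theta> \<in> Forms L B0 {..<n + n}" using \<theta> by (simp add: B0_def Forms_def)
  then have R: "definable B0 (n + n) (\<lambda>w. holds U \<theta> (g w))"
    by (rule definable_reindex[OF definable_holds small_Dom[OF B0(1)] f(1)]) (simp_all add: g_def del: upt_Suc)
  have sat: "sat U h \<theta> = holds U \<theta> (g (map h xs @ map h ys))" for h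
  proof (rule sat_eq_holds)
    show "fv \<theta> \<subseteq> {..<n + n}" using \<theta> by (simp add: Forms_def)
    fix i assume i: "i < n + n"
    have "map h xs @ map h ys = map h (xs @ ys)" by simp
    then show "h i = g (map h xs @ map h ys) ! i"
      using f[OF i] i xs ys unfolding g_def by (simp del: map_append)
  qed
  have morley_list: "morley_list B0 [map h xs, map h ys]"
    if "B0 \<subseteq> B'" "realizes_over (map h ys) B'" "realizes_over (map h xs) (B' \<union> h ` set ys)" for B' h
    using realizes_over_mono[OF that(2,1)] realizes_over_mono[OF that(3), of "B0 \<union> h ` set ys"] that(1) by auto
  have same: "sat U h \<theta> = sat U e \<theta>"
    if h: "B0 \<subseteq> B'" "realizes_over (map h ys) B'" "realizes_over (map h xs) (B' \<union> h ` set ys)" for B' h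
  proof -
    have "eqtype B0 (n + n) (map h xs @ map h ys) (map e xs @ map e ys)"
      using morley_list_eqtype[OF B0 _ morley_list[OF h] morley_list[OF B0B e]] by (simp add: mult_2 algebra_simps)
    from eqtypeD[OF this R] show ?thesis by (simp only: sat)
  qed
  show ?thesis
  proof
    assume "\<theta> \<in> morley_product L \<kappa> U (Dom M) xs p ys p"
    then have *: "\<And>B e. Dom M \<union> pars \<theta> \<subseteq> B \<and> B \<subseteq> Dom U \<and> |B| <o \<kappa> \<and>
        realizes U (length ys) (map e ys) (restr p B) \<and>
        realizes U (length xs) (map e xs) (restr p (B \<union> e ` set ys)) \<Longrightarrow> sat U e \<theta>"
      unfolding morley_product_def by blast
    have "B \<union> e ` set ys \<subseteq> Dom U"
      using small_Dom[OF B(1)] realizes_over_tuple[OF e(1)] by (auto simp: tuples_def)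
    from realizes_iff_realizes_over[OF this] realizes_iff_realizes_over[OF small_Dom[OF B(1)]] e B xs ys
    show "sat U e \<theta>" by (intro *[of B]) (simp add: small_def)
  next
    assume sat_e: "sat U e \<theta>"
    have "sat U h \<theta>" if h: "Dom M \<union> pars \<theta> \<subseteq> B' \<and> B' \<subseteq> Dom U \<and> |B'| <o \<kappa> \<and>
        realizes U (length ys) (map h ys) (restr p B') \<and>
        realizes U (length xs) (map h xs) (restr p (B' \<union> h ` set ys))" for B' h
    proof -
      have hU: "B' \<union> h ` set ys \<subseteq> Dom U" using h by (auto simp: realizes_def tuples_def)
      have "realizes_over (map h ys) B'" "realizes_over (map h xs) (B' \<union> h ` set ys)"
        using h realizes_iff_realizes_over[OF hU] realizes_iff_realizes_over[of B'] xs ys by simp_all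
      from same[OF _ this] h sat_e show ?thesis by (simp add: B0_def)
    qed
    then show "\<theta> \<in> morley_product L \<kappa> U (Dom M) xs p ys p"
      using \<theta> V unfolding morley_product_def by auto
  qed
qed

lemma map_nth_upt_append:
  assumes "length a = n" "length b = n"
  shows "map (\<lambda>i. (a @ b) ! i) [0..<n] = a" "map (\<lambda>i. (a @ b) ! i) [n..<2 * n] = b"
proof -
  show "map (\<lambda>i. (a @ b) ! i) [0..<n] = a"
    by (rule nth_equalityI) (simp_all add: assms nth_append)
  show "map (\<lambda>i. (a @ b) ! i) [n..<2 * n] = b"
    by (rule nth_equalityI) (simp_all add: assms nth_append)
qed

lemma morley_product_xy_iff:
  assumes \<theta>: "\<theta> \<in> Forms L (Dom U) {..<n + n}" and B: "small B" "Dom M \<union> pars \<theta> \<subseteq> B"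
    and ab: "realizes_over b B" "realizes_over a (B \<union> set b)"
  shows "\<theta> \<in> morley_product L \<kappa> U (Dom M) [0..<n] p [n..<2 * n] p \<longleftrightarrow> holds U \<theta> (a @ b)"
proof -
  let ?e = "\<lambda>i. (a @ b) ! i"
  have len: "length a = n" "length b = n"
    using realizes_over_tuple[OF ab(1)] realizes_over_tuple[OF ab(2)] by (simp_all add: tuples_def)
  note e = map_nth_upt_append[OF len]
  have im: "?e ` set [n..<2 * n] = set b" using arg_cong[OF e(2), of set] by simp
  have V: "set [0..<n] \<union> set [n..<2 * n] = {..<n + n}" by auto
  have "realizes_over (map ?e [n..<2 * n]) B" "realizes_over (map ?e [0..<n]) (B \<union> ?e ` set [n..<2 * n])"
    unfolding e im by (rule ab)+
  from morley_product_iff[OF _ _ V \<theta> B this] show ?thesis by (simp add: holds_def)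
qed

lemma morley_product_yx_iff:
  assumes \<theta>: "\<theta> \<in> Forms L (Dom U) {..<n + n}" and B: "small B" "Dom M \<union> pars \<theta> \<subseteq> B"
    and ab: "realizes_over a B" "realizes_over b (B \<union> set a)"
  shows "\<theta> \<in> morley_product L \<kappa> U (Dom M) [n..<2 * n] p [0..<n] p \<longleftrightarrow> holds U \<theta> (a @ b)"
proof -
  let ?e = "\<lambda>i. (a @ b) ! i"
  have len: "length a = n" "length b = n"
    using realizes_over_tuple[OF ab(1)] realizes_over_tuple[OF ab(2)] by (simp_all add: tuples_def)
  note e = map_nth_upt_append[OF len]
  have im: "?e ` set [0..<n] = set a" using arg_cong[OF e(1), of set] by simp
  have V: "set [n..<2 * n] \<union> set [0..<n] = {..<n + n}" by auto
  have "realizes_over (map ?e [0..<n]) B" "realizes_over (map ?e [n..<2 * n]) (B \<union> ?e ` set [0..<n])"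
    unfolding e im by (rule ab)+
  from morley_product_iff[OF _ _ V \<theta> B this] show ?thesis by (simp add: holds_def)
qed

lemma morley_product_commutes:
  assumes "definable_over L U (Dom M) n p" "finitely_satisfiable_in U (Dom M) n p"
  shows "morley_product L \<kappa> U (Dom M) [0..<n] p [n..<2 * n] p =
    morley_product L \<kappa> U (Dom M) [n..<2 * n] p [0..<n] p" (is "?xy = ?yx")
proof (rule set_eqI)
  fix \<theta>
  show "\<theta> \<in> ?xy \<longleftrightarrow> \<theta> \<in> ?yx"
  proof (cases "\<theta> \<in> Forms L (Dom U) {..<n + n}")
    case False
    have "{0..<n} \<union> {n..<2 * n} = {..<n + n}" "{n..<2 * n} \<union> {0..<n} = {..<n + n}" by auto
    with False show ?thesis unfolding morley_product_def by simp
  next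
    case \<theta>: True
    define B where "B = Dom M \<union> pars \<theta>"
    obtain ps where ps: "set ps = pars \<theta>" using finite_list[OF finite_pars[of \<theta>]] by (rule exE)
    have "small (pars \<theta>)" using \<theta> ps small_set[of ps] by (simp add: Forms_def)
    then have B: "small B" "Dom M \<subseteq> B" "Dom M \<union> pars \<theta> \<subseteq> B"
      unfolding B_def by (auto intro: small_Un[OF small_Dom_M])
    obtain b where b: "realizes_over b B" using ex_realizes_over[OF B(1)] by blast
    obtain a where a: "realizes_over a (B \<union> set b)"
      using ex_realizes_over[OF small_Un[OF B(1) small_tuple[OF realizes_over_tuple[OF b]]]] by blast
    \<comment> \<open>The tuple \<open>b\<close> serves twice: as the \<open>y\<close>-part of the
      first product, with \<open>a\<close>, and as the \<open>x\<close>-part of the second, with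
      \<open>b'\<close>.\<close>
    obtain b' where b': "realizes_over b' (B \<union> set b)"
      using ex_realizes_over[OF small_Un[OF B(1) small_tuple[OF realizes_over_tuple[OF b]]]] by blast
    have "\<theta> \<in> Forms L B {..<n + n}" using \<theta> by (simp add: B_def Forms_def)
    then have Q: "definable B (n + n) (holds U \<theta>)" by (rule definable_holds)
    note commute = morley_pair_commutes[OF assms B(1,2) b a b b']
    have "holds U \<theta> (a @ b) = holds U \<theta> (b @ b')"
      using commute[OF Q] commute[OF definable_not[OF Q]] by blast
    then show ?thesis
      using morley_product_xy_iff[OF \<theta> B(1,3) b a] morley_product_yx_iff[OF \<theta> B(1,3) b b'] by simp
  qed
qed

end

section \<open>Permuting Morley sequences when the product commutes\<close>

locale symmetric_type_model = invariant_type_model +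
  assumes symmetric: "morley_product L \<kappa> U (Dom M) [0..<n] p [n..<2 * n] p =
    morley_product L \<kappa> U (Dom M) [n..<2 * n] p [0..<n] p"
begin

text \<open>Over \<open>B\<close> the pair \<open>(a, b)\<close> realizes the product taken in one
  order. A fresh \<open>a'\<close> realizing \<open>p\<close> over \<open>B\<close> and
  \<open>b\<close> gives a pair \<open>(a', b)\<close> for the other order. Since the two products
  agree, \<open>a\<close> satisfies every condition with parameters in \<open>B\<close> and
  \<open>b\<close> that \<open>a'\<close> does.\<close>

lemma realizes_over_symmetric:
  assumes B: "small B" "Dom M \<subseteq> B" and a: "realizes_over a B" and b: "realizes_over b (B \<union> set a)"
  shows "realizes_over a (B \<union> set b)"
  unfolding realizes_over_def
proof (intro conjI allI impI realizes_over_tuple[OF a])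
  fix P assume P: "definable (B \<union> set b) n P" "in_type P"
  have len: "length b = n" using realizes_over_tuple[OF b] by (rule length_tuples)
  have BU: "B \<subseteq> Dom U" using B(1) by (rule small_Dom)
  have Bb: "small (B \<union> set b)" by (rule small_Un[OF B(1) small_tuple[OF realizes_over_tuple[OF b]]])
  from P(1) obtain Q where Q: "definable B (n + length b) Q" "\<And>x. x \<in> T n \<Longrightarrow> P x = Q (x @ b)"
    by (rule definable_unplug) (rule that; simp)
  then obtain \<theta> where \<theta>: "\<theta> \<in> Forms L B {..<n + n}" "\<forall>z\<in>T (n + n). holds U \<theta> z = Q z"
    unfolding definable_def len by (elim bexE) (rule that)
  have \<theta>': "\<theta> \<in> Forms L (Dom U) {..<n + n}" "Dom M \<union> pars \<theta> \<subseteq> B"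
    using \<theta>(1) BU B(2) by (auto simp: Forms_def)
  obtain a' where a': "realizes_over a' (B \<union> set b)" using ex_realizes_over[OF Bb] by blast
  have P_iff: "P x = holds U \<theta> (x @ b)" if "x \<in> T n" for x
    using \<theta>(2)[rule_format, OF tuples_append[OF that realizes_over_tuple[OF b]]] Q(2)[OF that] by simp
  have "P a'" using realizes_overD[OF a' P(1) small_Dom[OF Bb]] P(2) by simp
  then have "holds U \<theta> (a' @ b)" using P_iff[OF realizes_over_tuple[OF a']] by simp
  then have "holds U \<theta> (a @ b)"
    using morley_product_xy_iff[OF \<theta>'(1) B(1) \<theta>'(2) realizes_over_mono[OF b Un_upper1] a']
      morley_product_yx_iff[OF \<theta>'(1) B(1) \<theta>'(2) a b] symmetric by simp
  then show "P a" using P_iff[OF realizes_over_tuple[OF a]] by simp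
qed

text \<open>The head moves inward past one neighbour at a time: to pass \<open>y\<close>, symmetry
  is used over \<open>B\<close> together with all the remaining entries, after which
  \<open>y\<close> realizes \<open>p\<close> over \<open>x\<close> as well.\<close>

lemma morley_list_insert:
  assumes "small B" "Dom M \<subseteq> B" "morley_list B (x # ys @ zs)"
  shows "morley_list B (ys @ x # zs)"
  using assms(3)
proof (induction ys)
  case (Cons y ys)
  let ?S = "\<Union> (set ` set (ys @ zs))"
  have yzs: "morley_list B (ys @ zs)" and y: "realizes_over y (B \<union> ?S)" and x: "realizes_over x (B \<union> ?S \<union> set y)"
    using Cons.prems by (simp_all add: Un_ac)
  have "small (B \<union> ?S)" by (rule small_Un[OF assms(1) small_tuples[OF morley_list_tuples[OF yzs]]])
  moreover have "Dom M \<subseteq> B \<union> ?S" using assms(2) by blast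
  ultimately have "realizes_over y (B \<union> ?S \<union> set x)" using y x by (rule realizes_over_symmetric)
  moreover have "morley_list B (ys @ x # zs)"
    using yzs realizes_over_mono[OF x Un_upper1] by (intro Cons.IH) simp
  ultimately show ?case by (simp add: Un_ac)
qed simp

text \<open>Remove the largest index: its term realizes \<open>p\<close> over all the others, so it
  may head the list, and from there it is moved to its proper place. The shorter list is handled by
  induction.\<close>

lemma morley_list_distinct:
  assumes a: "morley (Dom M) a" and "distinct is"
  shows "morley_list (Dom M) (map a is)"
  using assms(2)
proof (induction "length is" arbitrary: "is")
  case (Suc l)
  define m where "m = Max (set is)"
  have "is \<noteq> []" using Suc.hyps(2) by auto
  then have "m \<in> set is" by (simp add: m_def)
  then obtain js ks where split: "is = js @ m # ks" by (meson split_list)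
  have "i < m" if "i \<in> set (js @ ks)" for i
  proof -
    have "i \<in> set is" using that unfolding split by auto
    then have "i \<le> m" by (simp add: m_def)
    moreover have "i \<noteq> m" using that Suc.prems unfolding split by auto
    ultimately show ?thesis by simp
  qed
  then have "\<Union> (set ` set (map a (js @ ks))) \<subseteq> (\<Union>i<m. set (a i))" by auto
  from realizes_over_mono[OF a[unfolded morley_def, THEN spec] Un_mono[OF order_refl this]]
  have "realizes_over (a m) (Dom M \<union> \<Union> (set ` set (map a (js @ ks))))" .
  moreover have "morley_list (Dom M) (map a (js @ ks))"
  proof (rule Suc.hyps(1))
    show "l = length (js @ ks)" using Suc.hyps(2) unfolding split by simp
    show "distinct (js @ ks)" using Suc.prems unfolding split by simp
  qed
  ultimately have "morley_list (Dom M) (a m # map a js @ map a ks)" by simp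
  from morley_list_insert[OF small_Dom_M order_refl this] show ?case unfolding split by simp
qed simp

lemma morley_totally_indiscernible:
  assumes a: "morley (Dom M) a"
  shows "totally_indiscernible L U (Dom M) n a"
  unfolding totally_indiscernible_iff_eqtype[of a, OF morley_tuple[OF a]]
proof (intro allI impI)
  fix "is" js :: "nat list"
  assume d: "distinct is \<and> distinct js \<and> length is = length js"
  then show "eqtype (Dom M) (length is * n) (concat (map a is)) (concat (map a js))"
    using morley_list_eqtype[OF small_Dom_M order_refl _ morley_list_distinct[OF a] morley_list_distinct[OF a], of "is" js] by simp
qed

end

theorem theorem4p7:
  fixes L :: "('f, 'r) lang"
    and T :: "('f, 'r, 'u) fm set"
    and \<kappa> :: "'k rel"
    and U M M' :: "('f, 'r, 'u) struct"
    and n :: nat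
    and p :: "('f, 'r, 'u) fm set"
  assumes "complete_theory L T"
    and "monster L T \<kappa> U"
    and "models M T" and "elem_sub L M U" and "|Dom M| <o \<kappa>"
    and "global_type L U n p" and "invariant_type L U (Dom M) n p"
    and "elem_sub L M M'" and "elem_sub L M' U"
    and "\<exists>a. morley_sequence U (Dom M) n p a \<and> (\<forall>i. set (a i) \<subseteq> Dom M')"
    and "eventually_NIP L U (Dom M')"
  defines "cond_i \<equiv> (\<forall>a. morley_sequence U (Dom M) n p a \<longrightarrow> is_limit_type L U n a p)"
    and "cond_ii \<equiv> (definable_over L U (Dom M) n p \<and> finitely_satisfiable_in U (Dom M) n p)"
    and "cond_iii \<equiv>
           (morley_product L \<kappa> U (Dom M) [0..<n] p [n..<2 * n] p =
            morley_product L \<kappa> U (Dom M) [n..<2 * n] p [0..<n] p)"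
    and "cond_iv \<equiv>
           (\<forall>a. morley_sequence U (Dom M) n p a \<longrightarrow> totally_indiscernible L U (Dom M) n a)"
  shows "(cond_i \<longleftrightarrow> cond_ii) \<and> (cond_ii \<longleftrightarrow> cond_iii) \<and> (cond_iii \<longleftrightarrow> cond_iv)"
proof -
  interpret invariant_type_model L U \<kappa> n p M
    using assms(2,4-7) by unfold_locales (auto simp: monster_def)
  note ms = morley_sequence_iff_morley[OF M_sub]
  have lim: "is_limit_type L U n a p \<longleftrightarrow> limit a" if "morley (Dom M) a" for a
    by (rule is_limit_type_iff_limit) (rule morley_tuple[OF that])
  \<comment> \<open>This one sequence serves at both ends of the cycle: under (i) its limit is
    \<open>p\<close>, which gives (ii), and from (iv) to (i) it is the sequence in \<open>M'\<close>
    to which eventual NIP applies.\<close>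
  obtain c where c: "morley (Dom M) c" "\<And>i. set (c i) \<subseteq> Dom M'" using assms(10) ms by blast
  have "cond_ii" if "cond_i"
  proof -
    have "limit c" using that c(1) ms lim[OF c(1)] by (simp add: cond_i_def)
    note c = c(1) this
    show ?thesis
      unfolding cond_ii_def definable_over_iff finitely_satisfiable_iff
      using limit_definable[OF c] limit_finitely_satisfiable[OF c] by simp
  qed
  moreover have "cond_iii" if "cond_ii"
    using that morley_product_commutes unfolding cond_ii_def cond_iii_def by simp
  moreover have "cond_iv" if "cond_iii"
  proof -
    interpret symmetric_type_model L U \<kappa> n p M
      using that by unfold_locales (simp add: cond_iii_def)
    show ?thesis using morley_totally_indiscernible by (simp add: cond_iv_def ms)
  qed
  moreover have "cond_i" if "cond_iv"
  proof -
    have "totally_indiscernible L U (Dom M) n a" if "morley (Dom M) a" for a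
      using \<open>cond_iv\<close> that by (simp add: cond_iv_def ms)
    from limit_if_totally_indiscernible[OF this c assms(11)] show ?thesis
      by (simp add: cond_i_def ms lim)
  qed
  ultimately show ?thesis by blast
qed

end
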